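(* If $\mathcal{X}$ is a surface with a constant curvature $k>0$, then $$D_{L_\gamma}\le\frac{1}{\sqrt{k}}\left(\theta_0(\gamma)+\frac{\pi}{2}\right),$$ where, for $1\le\gamma<2$, $\theta_0(\gamma)$ is the inverse function of $$\gamma_0(\theta)=\begin{cases}\left[\log_2\dfrac{\pi+2\theta}{2\arccos\left\{\sin^2\theta+\cos^2\theta\left(1-\frac{1}{2(1-\sin\theta)}\right)^{1/2}\right\}}\right]^{-1} & \text{for } 0\le\theta\le\pi/6,\\[3ex] \left[\log_2\dfrac{\pi-2\theta}{\arccos(\sin^2\theta)}\right]^{-1} & \text{for } \pi/6<\theta\le\pi/2,\end{cases}$$ and $\theta_0(\gamma)=\pi/2$ for $\gamma\ge 2$.
   Context: $\mathcal{X}$ is regarded as a geodesic metric space with metric $d$, i.e. $d(x,x')$ is the length of a shortest path (geodesic) between $x$ and $x'$. The diameter of a subset $A\subset\mathcal{X}$ is the length of the longest geodesic in $A$. For $\gamma\in[1,\infty]$, $\mathcal{C}_{L_\gamma}$ is the class of subsets $A\subset\mathcal{X}$ such that for any probability measure whose support is in $A$ and non-empty (with $X$ a random variable having this distribution), the intrinsic $L_\gamma$-mean $$\mu=\mathop{\arg\min}_{m\in\mathcal{X}}E[d(X,m)^\gamma]$$ exists uniquely. $D_{L_\gamma}$ is the largest value (including $\infty$) such that every subset of $\mathcal{X}$ whose diameter is less than this value belongs to $\mathcal{C}_{L_\gamma}$. The value of $\gamma_0$ at $\theta=\pi/2$, where the fraction reads $0/0$, is understood as the limit $\theta\to\pi/2$,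 which is $2$.
   Formalization: The surface is additionally assumed to be complete as a metric space; without this the bound fails, e.g. for a small open convex disc of the sphere with γ = 2, where D is infinite. *)

theory Defs
  imports "HOL-Probability.Probability_Measure" "HOL-Probability.Essential_Supremum"
begin

section \<open>Geodesic spaces and surfaces of constant curvature\<close>

text \<open>All pairs of points are joined by a path whose length is their distance.\<close>

definition geodesic_space :: "'a::metric_space itself \<Rightarrow> bool" where
  "geodesic_space _ \<longleftrightarrow>
     (\<forall>x y :: 'a. \<exists>g. g 0 = x \<and> g (dist x y) = y \<and>
        (\<forall>s\<in>{0..dist x y}. \<forall>t\<in>{0..dist x y}. dist (g s) (g t) = \<bar>s - t\<bar>))"

text \<open>The model surface of curvature \<open>k > 0\<close>: the sphere of radius \<open>1 / sqrt k\<close> with its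
  intrinsic (great-circle) distance, not the chordal distance of the ambient space.\<close>

definition model_sphere :: "real \<Rightarrow> (real ^ 3) set" where
  "model_sphere k = sphere 0 (1 / sqrt k)"

definition model_dist :: "real \<Rightarrow> real ^ 3 \<Rightarrow> real ^ 3 \<Rightarrow> real" where
  "model_dist k p q = arccos (k * (p \<bullet> q)) / sqrt k"

text \<open>A surface of constant curvature \<open>k > 0\<close>, in the metric sense: a complete geodesic space
  in which every point has a ball isometric to a ball of the same radius in the model sphere.
  Neither simple connectedness nor orientability is required, so the projective plane is
  included. Completeness cannot be dropped: small open convex discs of the sphere
  have unique means for every measure if, for instance, \<open>\<gamma> = 2\<close>.\<close>

definition constant_curvature_surface :: "'a::metric_space itself \<Rightarrow> real \<Rightarrow> bool" where
  "constant_curvature_surface T k \<longleftrightarrow>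
     complete (UNIV :: 'a set) \<and> geodesic_space T \<and>
     (\<forall>x::'a. \<exists>\<epsilon>>0. \<exists>f. f x \<in> model_sphere k \<and>
        f ` ball x \<epsilon> = {q \<in> model_sphere k. model_dist k (f x) q < \<epsilon>} \<and>
        (\<forall>y\<in>ball x \<epsilon>. \<forall>z\<in>ball x \<epsilon>. model_dist k (f y) (f z) = dist y z))"

section \<open>Intrinsic means\<close>

definition support :: "'a::topological_space measure \<Rightarrow> 'a set" where
  "support P = {x. \<forall>U. open U \<longrightarrow> x \<in> U \<longrightarrow> emeasure P U > 0}"

text \<open>The objective \<open>E[d(X,m)\<^sup>\<gamma>]\<close>. For \<open>\<gamma> = \<infinity>\<close> this expression is to be read as
  the \<open>L\<^sub>\<infinity>\<close> norm of \<open>d(X,m)\<close>; for finite \<open>\<gamma>\<close> minimising it is the same as minimising the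
  \<open>L\<^sub>\<gamma>\<close> norm.\<close>

definition mean_objective :: "ennreal \<Rightarrow> 'a::metric_space measure \<Rightarrow> 'a \<Rightarrow> ennreal" where
  "mean_objective \<gamma> P m =
     (if \<gamma> = \<infinity> then esssup P (\<lambda>x. ennreal (dist x m))
      else \<integral>\<^sup>+ x. ennreal (dist x m powr enn2real \<gamma>) \<partial>P)"

definition is_intrinsic_mean :: "ennreal \<Rightarrow> 'a::metric_space measure \<Rightarrow> 'a \<Rightarrow> bool" where
  "is_intrinsic_mean \<gamma> P m \<longleftrightarrow> is_arg_min (mean_objective \<gamma> P) (\<lambda>_. True) m"

definition unique_mean_sets :: "ennreal \<Rightarrow> 'a::metric_space set set" where
  "unique_mean_sets \<gamma> =
     {A. \<forall>P :: 'a measure. prob_space P \<longrightarrow> sets P = sets borel \<longrightarrow>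
           support P \<noteq> {} \<longrightarrow> support P \<subseteq> A \<longrightarrow> (\<exists>!m. is_intrinsic_mean \<gamma> P m)}"

text \<open>Unlike \<^const>\<open>diameter\<close>, this is also meaningful for unbounded sets.\<close>

definition ediameter :: "'a::metric_space set \<Rightarrow> ennreal" where
  "ediameter A = (SUP x\<in>A. SUP y\<in>A. ennreal (dist x y))"

text \<open>The supremum is attained: if \<open>ediameter A\<close> is below it, then it is below some admissible
  value.\<close>

definition D_L :: "'a::metric_space itself \<Rightarrow> ennreal \<Rightarrow> ennreal" where
  "D_L _ \<gamma> = Sup {v. \<forall>A :: 'a set. ediameter A < v \<longrightarrow> A \<in> unique_mean_sets \<gamma>}"

section \<open>The angle in the bound\<close>

text \<open>At \<open>\<theta> = pi / 2\<close> the last fraction is \<open>0 / 0\<close>; the whole expression tends to 2 there.\<close>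

definition gamma0 :: "real \<Rightarrow> real" where
  "gamma0 \<theta> =
     (if \<theta> = pi / 2 then 2
      else if \<theta> \<le> pi / 6 then
        inverse (log 2 ((pi + 2 * \<theta>) /
          (2 * arccos ((sin \<theta>)\<^sup>2 + (cos \<theta>)\<^sup>2 * sqrt (1 - 1 / (2 * (1 - sin \<theta>)))))))
      else inverse (log 2 ((pi - 2 * \<theta>) / arccos ((sin \<theta>)\<^sup>2))))"

definition theta0 :: "ennreal \<Rightarrow> real" where
  "theta0 \<gamma> = (if \<gamma> < 2 then inv_into {0..pi / 2} gamma0 (enn2real \<gamma>) else pi / 2)"

end

theory Submission
  imports Defs
begin

text \<open>The unit sphere covers the surface by a local isometry (for angles, i.e. distances times
  \<open>sqrt k\<close>), constructed by continuing a chart along meridians. If this covering is not injective,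
  the shortest geodesic loop it produces has length at most \<open>pi\<close>, and two opposite points of the
  loop have two midpoints; the mean of the two Dirac masses is then not unique, for every
  \<open>\<gamma>\<close>. Otherwise the surface is the sphere. For \<open>\<gamma> \<ge> 2\<close> an antipodal pair suffices. For
  \<open>\<gamma> < 2\<close>, take the south pole with weight \<open>w\<close> and two points at latitude \<open>\<theta>\<close> with equal
  weights. If the mean were unique for all \<open>w\<close>, it would lie on the plane of symmetry and, for
  some \<open>w\<close>, have latitude \<open>\<theta>\<close>. But if \<open>\<gamma> = gamma0 \<theta>\<close>, then each of the two points is at
  least as good as any point on that plane at that latitude.\<close>

section \<open>The round sphere\<close>

text \<open>The surface is known only through its metric, so the covering must be assembled from
  isometric balls. What makes continuation and lifting possible is a positive lower bound on their
  radii; completeness yields it through compactness of closed balls, as in the Hopf-Rinow theorem.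
  The function \<open>gamma0\<close> comes from a comparison of two candidates. Let b be the angle
  between the two points at latitude \<theta>, and a the angle from either of them to the point of
  that latitude halfway between them. Moving from the halfway point to one of the two keeps the
  distance to the south pole and changes the joint cost of the two from 2 a^\<gamma> to b^\<gamma>.
  The critical exponent solves b^\<gamma> = 2 a^\<gamma>, so it is the inverse of log_2 (b / a). The
  configuration has diameter pi / 2 + \<theta> as long as b does not exceed it. Since a minimiser
  may jump as the weight w varies, the height \<theta> is reached by covering the weights with two
  closed sets and using that the unit interval is connected.\<close>

definition ang :: "'a::real_inner \<Rightarrow> 'a \<Rightarrow> real" where
  "ang p q = arccos (p \<bullet> q)"

definition cap :: "'a::real_inner \<Rightarrow> real \<Rightarrow> 'a set" where
  "cap q r = {w \<in> sphere 0 1. ang q w < r}"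

lemma inner_unit_bounds:
  fixes p q :: "'a::real_inner"
  assumes "norm p = 1" "norm q = 1"
  shows "-1 \<le> p \<bullet> q" "p \<bullet> q \<le> 1"
  using Cauchy_Schwarz_ineq2[of p q] assms by auto

lemma cos_ang:
  assumes "norm p = 1" "norm q = 1"
  shows "cos (ang p q) = p \<bullet> q"
  unfolding ang_def using inner_unit_bounds[OF assms] by (simp add: cos_arccos)

lemma ang_bounds:
  assumes "norm p = 1" "norm q = 1"
  shows "0 \<le> ang p q" "ang p q \<le> pi"
  unfolding ang_def using inner_unit_bounds[OF assms]
  by (auto intro: arccos_lbound arccos_ubound)

lemma ang_commute: "ang p q = ang q p"
  by (simp add: ang_def inner_commute)

lemma ang_self: "norm p = 1 \<Longrightarrow> ang p p = 0"
  by (simp add: ang_def power2_norm_eq_inner[symmetric])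

lemma ang_eq_0_iff:
  assumes "norm p = 1" "norm q = 1"
  shows "ang p q = 0 \<longleftrightarrow> p = q"
proof
  assume "ang p q = 0"
  then have "p \<bullet> q = 1" using cos_ang[OF assms] by simp
  then have "(norm (p - q))\<^sup>2 = 0"
    using assms by (simp add: power2_norm_eq_inner algebra_simps inner_commute norm_eq_1)
  then show "p = q" by simp
qed (use assms ang_self in auto)

lemma ang_eqI:
  assumes "p \<bullet> q = cos t" "0 \<le> t" "t \<le> pi"
  shows "ang p q = t"
  using assms by (simp add: ang_def arccos_cos)

text \<open>The inner product of the components of \<open>a\<close> and \<open>c\<close> orthogonal
  to \<open>b\<close> is \<open>z - x * y\<close>, and their norms are the sines of the two angles.
  Cauchy-Schwarz therefore compares cos (ang a c) with the addition formula for the cosine.\<close>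

lemma ang_triangle:
  assumes a: "norm a = 1" and b: "norm b = 1" and c: "norm c = 1"
  shows "ang a c \<le> ang a b + ang b c"
proof (cases "ang a b + ang b c \<le> pi")
  case False
  then show ?thesis using ang_bounds(2)[OF a c] by linarith
next
  case True
  define x y z where "x = a \<bullet> b" and "y = b \<bullet> c" and "z = a \<bullet> c"
  have sx: "sin (ang a b) = sqrt (1 - x\<^sup>2)" and sy: "sin (ang b c) = sqrt (1 - y\<^sup>2)"
    unfolding ang_def x_def y_def
    using inner_unit_bounds[OF a b] inner_unit_bounds[OF b c] by (auto simp: sin_arccos)
  have aa: "a \<bullet> a = 1" "b \<bullet> b = 1" "c \<bullet> c = 1" using a b c by (auto simp: norm_eq_1)
  let ?u = "a - x *\<^sub>R b" and ?v = "c - y *\<^sub>R b"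
  have "?u \<bullet> ?v = z - x * y"
    using aa by (simp add: algebra_simps x_def y_def z_def inner_commute)
  moreover have "norm ?u = sqrt (1 - x\<^sup>2)" "norm ?v = sqrt (1 - y\<^sup>2)"
    using aa by (simp_all add: norm_eq_sqrt_inner algebra_simps x_def y_def inner_commute power2_eq_square)
  ultimately have "\<bar>z - x * y\<bar> \<le> sqrt (1 - x\<^sup>2) * sqrt (1 - y\<^sup>2)"
    using Cauchy_Schwarz_ineq2[of ?u ?v] by simp
  then have "cos (ang a b + ang b c) \<le> cos (ang a c)"
    by (simp add: cos_add sx sy cos_ang a b c flip: x_def y_def z_def)
  then show ?thesis
    using cos_mono_le_eq[of "ang a b + ang b c" "ang a c"] True
      ang_bounds[OF a b] ang_bounds[OF b c] ang_bounds[OF a c] by simp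
qed

lemma chord_le_ang:
  assumes "norm p = 1" "norm q = 1"
  shows "dist p q \<le> ang p q"
proof -
  define t where "t = ang p q"
  have t: "0 \<le> t" "t \<le> pi" using ang_bounds[OF assms] by (auto simp: t_def)
  have "(dist p q)\<^sup>2 = 2 - 2 * cos t"
    using assms by (simp add: dist_norm power2_norm_eq_inner algebra_simps inner_commute norm_eq_1 t_def cos_ang)
  also have "\<dots> = (2 * sin (t/2))\<^sup>2"
    using cos_double_sin[of "t/2"] by (simp add: power2_eq_square)
  also have "\<dots> \<le> t\<^sup>2"
    using sin_x_le_x[of "t/2"] sin_ge_zero[of "t/2"] t by (intro power_mono) auto
  finally show ?thesis using t(1) unfolding t_def by (rule power2_le_imp_le)
qed

lemma continuous_on_ang [continuous_intros]:
  assumes "continuous_on S f" "continuous_on S g"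
    and "\<And>x. x \<in> S \<Longrightarrow> norm (f x) = 1" "\<And>x. x \<in> S \<Longrightarrow> norm (g x) = 1"
  shows "continuous_on S (\<lambda>x. ang (f x) (g x))"
  unfolding ang_def
  by (intro continuous_intros assms(1,2)) (use assms(3,4) inner_unit_bounds in blast)+

text \<open>A unit-speed great circle starting at \<open>a\<close> with velocity \<open>u\<close>,
  provided that \<open>a\<close> and \<open>u\<close> are orthonormal.\<close>

definition great_arc :: "'a::real_inner \<Rightarrow> 'a \<Rightarrow> real \<Rightarrow> 'a" where
  "great_arc a u t = cos t *\<^sub>R a + sin t *\<^sub>R u"

lemma inner_great_arc:
  assumes "norm a = 1" "norm u = 1" "a \<bullet> u = 0"
  shows "great_arc a u s \<bullet> great_arc a u t = cos (s - t)"
  using assms by (simp add: great_arc_def algebra_simps inner_commute norm_eq_1 cos_diff)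

lemma norm_great_arc:
  assumes "norm a = 1" "norm u = 1" "a \<bullet> u = 0"
  shows "norm (great_arc a u t) = 1"
  using inner_great_arc[OF assms, of t t] by (simp add: norm_eq_1)

lemma ang_great_arc:
  assumes "norm a = 1" "norm u = 1" "a \<bullet> u = 0" "\<bar>s - t\<bar> \<le> pi"
  shows "ang (great_arc a u s) (great_arc a u t) = \<bar>s - t\<bar>"
  using assms inner_great_arc[OF assms(1-3), of s t] by (intro ang_eqI) auto

lemma great_arc_0: "great_arc a u 0 = a"
  by (simp add: great_arc_def)

lemma exists_unit_orthogonal:
  fixes a :: "'a::euclidean_space"
  assumes "2 \<le> DIM('a)"
  obtains u where "norm u = 1" "a \<bullet> u = 0"
proof -
  have "dim {a} < DIM('a)" using assms dim_le_card'[of "{a}"] by simp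
  then obtain x where "x \<noteq> 0" "orthogonal a x"
    using orthogonal_to_subspace_exists[of "{a}"] by (metis orthogonal_commute span_base singletonI)
  then show thesis
    using that[of "x /\<^sub>R norm x"] by (auto simp: orthogonal_def)
qed

lemma exists_great_arc:
  fixes a b :: "'a::euclidean_space"
  assumes "2 \<le> DIM('a)" and a: "norm a = 1" and b: "norm b = 1"
  obtains u where "norm u = 1" "a \<bullet> u = 0" "b = great_arc a u (ang a b)"
proof -
  define v where "v = b - (a \<bullet> b) *\<^sub>R a"
  have nv: "norm v = sin (ang a b)"
    using a b inner_unit_bounds[OF a b]
    by (simp add: v_def norm_eq_sqrt_inner algebra_simps inner_commute power2_eq_square ang_def sin_arccos)
  have av: "a \<bullet> v = 0" using a by (simp add: v_def algebra_simps norm_eq_1)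
  show thesis
  proof (cases "v = 0")
    case True
    \<comment> \<open>Here \<open>b\<close> is \<open>a\<close> or \<open>- a\<close> and the sine
      vanishes, so every direction serves.\<close>
    obtain u where "norm u = 1" "a \<bullet> u = 0" using exists_unit_orthogonal[OF assms(1)] .
    then show ?thesis using True nv cos_ang[OF a b] by (intro that[of u]) (auto simp: great_arc_def v_def)
  next
    case False
    have "great_arc a (v /\<^sub>R norm v) (ang a b) = (a \<bullet> b) *\<^sub>R a + v"
      using False nv cos_ang[OF a b] by (simp add: great_arc_def flip: nv)
    then show ?thesis using False av by (intro that[of "v /\<^sub>R norm v"]) (auto simp: v_def)
  qed
qed

section \<open>Caps: topology and rigidity\<close>

lemma capI: "norm w = 1 \<Longrightarrow> ang q w < r \<Longrightarrow> w \<in> cap q r"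
  by (simp add: cap_def)

lemma capD: "w \<in> cap q r \<Longrightarrow> norm w = 1" "w \<in> cap q r \<Longrightarrow> ang q w < r"
  by (auto simp: cap_def)

lemma cap_subset_cap:
  assumes "norm q = 1" "norm p = 1" "ang p q + s \<le> r"
  shows "cap q s \<subseteq> cap p r"
  using assms ang_triangle[of p q] by (fastforce simp: cap_def)

lemma center_in_cap: "norm q = 1 \<Longrightarrow> 0 < r \<Longrightarrow> q \<in> cap q r"
  by (simp add: cap_def ang_self)

lemma cap_subset_ball: "norm q = 1 \<Longrightarrow> cap q r \<subseteq> ball q r"
  using chord_le_ang by (fastforce simp: cap_def)

lemma openin_cap:
  assumes "norm q = 1"
  shows "openin (top_of_set (sphere 0 1)) (cap q r)"
proof -
  have "continuous_on (sphere 0 1) (\<lambda>w. ang q w)"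
    using assms by (intro continuous_intros) auto
  then have "openin (top_of_set (sphere 0 1)) (sphere 0 1 \<inter> ang q -` {..<r})"
    by (rule continuous_openin_preimage_gen) simp
  also have "sphere 0 1 \<inter> ang q -` {..<r} = cap q r" by (auto simp: cap_def)
  finally show ?thesis .
qed

lemma cap_in_openin:
  assumes "openin (top_of_set (sphere 0 1)) U" "q \<in> U"
  obtains r where "0 < r" "cap q r \<subseteq> U"
proof -
  obtain e where "e > 0" "ball q e \<inter> sphere 0 1 \<subseteq> U"
    using assms openin_contains_ball by metis
  moreover have "norm q = 1" using assms openin_imp_subset by fastforce
  moreover have "cap q e \<subseteq> sphere 0 1" by (auto simp: cap_def)
  ultimately show ?thesis using cap_subset_ball[of q e] that[of e] by blast
qed

text \<open>Rigidity: a vector is determined by its inner products with an arbitrarily small cap.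
  The cap contains a point on the arc from \<open>q\<close> in the direction of \<open>x\<close>
  itself, and this point detects \<open>x\<close>.\<close>

lemma orthogonal_cap_imp_0:
  fixes x q :: "'a::real_inner"
  assumes q: "norm q = 1" and r: "0 < r" and x: "\<And>v. v \<in> cap q r \<Longrightarrow> x \<bullet> v = 0"
  shows "x = 0"
proof (rule ccontr)
  assume nz: "x \<noteq> 0"
  define u where "u = x /\<^sub>R norm x"
  have "x \<bullet> q = 0" using x center_in_cap[OF q r] by auto
  then have u: "norm u = 1" "q \<bullet> u = 0" using nz by (auto simp: u_def inner_commute)
  define t where "t = min (r/2) 1"
  have t: "0 < t" "t < r" "t < pi" using r pi_gt3 by (auto simp: t_def)
  have "great_arc q u t \<in> cap q r"
    using norm_great_arc[OF q u] ang_great_arc[OF q u, of 0 t] t by (intro capI) (auto simp: great_arc_0)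
  then have "sin t * (x \<bullet> u) = 0" using x[of "great_arc q u t"] \<open>x \<bullet> q = 0\<close> by (simp add: great_arc_def algebra_simps)
  moreover have "x \<bullet> u \<noteq> 0" using nz by (simp add: u_def)
  ultimately show False using sin_gt_zero[of t] t by simp
qed

lemma span_cap:
  fixes q :: "'a::euclidean_space"
  assumes "norm q = 1" "0 < r"
  shows "span (cap q r) = UNIV"
proof (rule ccontr)
  assume "span (cap q r) \<noteq> UNIV"
  then obtain x where "x \<noteq> 0" "\<And>v. v \<in> span (cap q r) \<Longrightarrow> orthogonal x v"
    using orthogonal_to_subspace_exists_gen[of "cap q r" UNIV] by (auto simp: span_UNIV psubset_eq)
  then show False using orthogonal_cap_imp_0[OF assms, of x] by (auto simp: orthogonal_def span_base)
qed

text \<open>Take \<open>T\<close> linear with the values of \<open>f\<close> on a basis contained in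
  \<open>C\<close>. It preserves inner products, hence is surjective; for \<open>u\<close> in
  \<open>C\<close> the vector \<open>f u - T u\<close> is orthogonal to the range of
  \<open>T\<close>, hence zero. Changes of charts thereby become rotations or reflections of the
  whole sphere.\<close>

lemma inner_preserving_extend:
  fixes f :: "'a::euclidean_space \<Rightarrow> 'a"
  assumes sp: "span C = UNIV" and f: "\<And>u v. u \<in> C \<Longrightarrow> v \<in> C \<Longrightarrow> f u \<bullet> f v = u \<bullet> v"
  obtains T where "orthogonal_transformation T" "\<And>u. u \<in> C \<Longrightarrow> T u = f u"
proof -
  obtain B where B: "B \<subseteq> C" "independent B" "C \<subseteq> span B"
    using maximal_independent_subset by blast
  then have spB: "span B = UNIV" using sp by (metis span_mono span_span top.extremum_uniqueI)
  obtain T where T: "linear T" "\<And>b. b \<in> B \<Longrightarrow> T b = f b"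
    using linear_independent_extend[OF B(2), of f] by auto
  have 1: "T x \<bullet> f b = x \<bullet> b" if "b \<in> B" for x b
  proof -
    have "x \<in> span B" using spB by simp
    then show ?thesis
    proof (induction rule: span_induct_alt)
      case base then show ?case using linear_0[OF T(1)] by simp
    next
      case (step c a y)
      then show ?case using T f B(1) that
        by (simp add: linear_add linear_scale inner_add_left subset_iff)
    qed
  qed
  have 2: "T x \<bullet> T y = x \<bullet> y" for x y
  proof -
    have "y \<in> span B" using spB by simp
    then show ?thesis
    proof (induction rule: span_induct_alt)
      case base then show ?case using linear_0[OF T(1)] by simp
    next
      case (step c b z)
      then show ?case using T 1 by (simp add: linear_add linear_scale inner_add_right)
    qed
  qed
  have orth: "orthogonal_transformation T" using T(1) 2 by (simp add: orthogonal_transformation_def)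
  have "T u = f u" if u: "u \<in> C" for u
  proof -
    have "(f u - T u) \<bullet> T y = 0" for y
    proof -
      have "y \<in> span B" using spB by simp
      then show ?thesis
      proof (induction rule: span_induct_alt)
        case base then show ?case using linear_0[OF T(1)] by simp
      next
        case (step c b z)
        have "(f u - T u) \<bullet> f b = 0" using f[of u b] B(1) step(1) 1[of b u] u by (auto simp: inner_diff_left)
        then show ?case using T step by (simp add: linear_add linear_scale inner_add_right)
      qed
    qed
    moreover have "surj T" using orth by (simp add: orthogonal_transformation_surj)
    ultimately have "(f u - T u) \<bullet> (f u - T u) = 0" by (metis surjD)
    then show ?thesis by simp
  qed
  with orth show ?thesis using that by blast
qed

section \<open>Charts of a surface of constant curvature\<close>

locale curved_surface =
  fixes k :: real and T :: "'a::metric_space itself"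
  assumes k_pos: "0 < k" and surface: "constant_curvature_surface T k"
begin

definition D :: "'a \<Rightarrow> 'a \<Rightarrow> real" where
  "D x y = sqrt k * dist x y"

lemma D_nonneg: "0 \<le> D x y" and D_self: "D x x = 0" and D_commute: "D x y = D y x"
  and D_eq_0_iff: "D x y = 0 \<longleftrightarrow> x = y"
  using k_pos by (auto simp: D_def dist_commute)

lemma D_triangle: "D x z \<le> D x y + D y z"
  using k_pos dist_triangle[of x z y] by (simp add: D_def flip: distrib_left)

lemma dist_eq_D: "dist x y = D x y / sqrt k"
  using k_pos by (simp add: D_def)

lemma exists_geodesic:
  fixes x y :: 'a
  obtains g where "g 0 = x" "g 1 = y"
    "\<And>s t. s \<in> {0..1} \<Longrightarrow> t \<in> {0..1} \<Longrightarrow> dist (g s) (g t) = \<bar>s - t\<bar> * dist x y"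
proof -
  have "geodesic_space T" using surface by (simp add: constant_curvature_surface_def)
  then obtain g where "g 0 = x" "g (dist x y) = y"
     and g': "\<forall>s\<in>{0..dist x y}. \<forall>t\<in>{0..dist x y}. dist (g s) (g t) = \<bar>s - t\<bar>"
    unfolding geodesic_space_def by (elim allE[of _ x] allE[of _ y]) blast
  note g = this(1,2) bspec[OF bspec[OF g']]
  show thesis
  proof (rule that[of "\<lambda>t. g (t * dist x y)"])
    fix s t :: real assume "s \<in> {0..1}" "t \<in> {0..1}"
    then have "s * dist x y \<in> {0..dist x y}" "t * dist x y \<in> {0..dist x y}"
      by (auto intro: mult_left_le_one_le)
    then show "dist (g (s * dist x y)) (g (t * dist x y)) = \<bar>s - t\<bar> * dist x y"
      using g(3) by (simp add: abs_mult flip: left_diff_distrib)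
  qed (use g in auto)
qed

text \<open>The inverse of a chart: for positive \<open>r\<close>, an isometry of the open cap onto
  the whole open \<open>D\<close>-ball of radius \<open>r\<close> around \<open>h q\<close>. As
  \<open>h\<close> is total, one function can be a patch around many centres, which is how the
  covering is expressed later.\<close>

definition patch :: "real ^ 3 \<Rightarrow> (real ^ 3 \<Rightarrow> 'a) \<Rightarrow> real \<Rightarrow> bool" where
  "patch q h r \<longleftrightarrow> norm q = 1 \<and> (\<forall>u\<in>cap q r. \<forall>v\<in>cap q r. D (h u) (h v) = ang u v)
     \<and> (\<forall>y. D (h q) y < r \<longrightarrow> y \<in> h ` cap q r)"

lemma patch_norm: "patch q h r \<Longrightarrow> norm q = 1"
  by (simp add: patch_def)

lemma patch_D: "patch q h r \<Longrightarrow> u \<in> cap q r \<Longrightarrow> v \<in> cap q r \<Longrightarrow> D (h u) (h v) = ang u v"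
  by (simp add: patch_def)

lemma patch_onto:
  assumes "patch q h r" "D (h q) y < r"
  obtains w where "w \<in> cap q r" "h w = y"
  using assms by (auto simp: patch_def)

lemma patch_subpatch:
  assumes h: "patch q h r" and p: "norm p = 1" and le: "ang q p + s \<le> r"
  shows "patch p h s"
proof (cases "0 < s")
  case False
  have "cap p s = {}" using False ang_bounds(1)[OF p] by (fastforce simp: cap_def)
  moreover have "\<not> D (h p) y < s" for y using False D_nonneg[of "h p" y] by simp
  ultimately show ?thesis using p by (simp add: patch_def)
next
  case True
  have q: "norm q = 1" using patch_norm[OF h] .
  have sub: "cap p s \<subseteq> cap q r" using cap_subset_cap[OF p q le] .
  have pc: "p \<in> cap q r" using True le p by (intro capI) auto
  have r: "0 < r" using True le ang_bounds(1)[OF q p] by simp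
  have "y \<in> h ` cap p s" if y: "D (h p) y < s" for y
  proof -
    have "D (h q) y < r"
      using D_triangle[of "h q" y "h p"] patch_D[OF h center_in_cap[OF q r] pc] y le by simp
    then obtain w where w: "w \<in> cap q r" "h w = y" using patch_onto[OF h] by blast
    then have "ang p w < s" using patch_D[OF h pc w(1)] y by simp
    then show ?thesis using w capD(1)[OF w(1)] by (auto intro: capI)
  qed
  then show ?thesis using p sub h by (auto simp: patch_def subset_iff)
qed

lemma patch_cong:
  assumes "patch q h r" "0 < r" "\<And>w. w \<in> cap q r \<Longrightarrow> h' w = h w"
  shows "patch q h' r"
proof -
  have "h' ` cap q r = h ` cap q r" "h' q = h q"
    using assms center_in_cap[of q r] patch_norm[OF assms(1)] by auto
  then show ?thesis using assms by (auto simp: patch_def)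
qed

text \<open>Uniqueness of continuation. Both maps cover the same ball, so \<open>h w\<close> is
  \<open>h' z\<close> for some \<open>z\<close>; then \<open>z\<close> and \<open>w\<close> have the
  same angles to a small cap where the maps agree, and coincide by rigidity.\<close>

lemma patch_agree:
  assumes h: "patch q h r" and h': "patch q h' r" and s: "0 < s"
    and eq: "\<And>w. w \<in> cap q s \<Longrightarrow> h w = h' w" and w: "w \<in> cap q r"
  shows "h w = h' w"
proof -
  have q: "norm q = 1" using patch_norm[OF h] .
  have r: "0 < r" using w ang_bounds(1)[of q w] q by (auto simp: cap_def)
  have qc: "q \<in> cap q r" "q \<in> cap q s" using q r s by (auto intro: center_in_cap)
  have "D (h' q) (h w) < r"
    using patch_D[OF h qc(1) w] eq[OF qc(2)] capD[OF w] by simp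
  then obtain z where z: "z \<in> cap q r" "h' z = h w" using patch_onto[OF h'] by blast
  have "(z - w) \<bullet> v = 0" if v: "v \<in> cap q (min r s)" for v
  proof -
    have v': "v \<in> cap q r" "v \<in> cap q s" using v by (auto simp: cap_def)
    have "ang z v = ang w v"
      using patch_D[OF h' z(1) v'(1)] patch_D[OF h w v'(1)] z eq[OF v'(2)] by simp
    then have "z \<bullet> v = w \<bullet> v" using cos_ang z(1) w v' by (metis capD(1))
    then show ?thesis by (simp add: inner_diff_left)
  qed
  then have "z - w = 0" using r s by (intro orthogonal_cap_imp_0[OF q, of "min r s"]) auto
  then show ?thesis using z by simp
qed

lemma patch_continuous:
  assumes h: "patch q h r"
  shows "continuous_on (cap q r) h"
  unfolding continuous_on_def
proof
  fix u assume u: "u \<in> cap q r"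
  have "continuous_on (cap q r) (\<lambda>v. ang v u / sqrt k)"
    using k_pos capD(1) u by (intro continuous_intros) auto
  then have "((\<lambda>v. ang v u / sqrt k) \<longlongrightarrow> ang u u / sqrt k) (at u within cap q r)"
    using u by (auto simp: continuous_on_def)
  then have "((\<lambda>v. ang v u / sqrt k) \<longlongrightarrow> 0) (at u within cap q r)"
    by (simp add: ang_self capD(1)[OF u])
  then have "((\<lambda>v. dist (h v) (h u)) \<longlongrightarrow> 0) (at u within cap q r)"
    by (rule Lim_transform_eventually)
      (use patch_D[OF h _ u] in \<open>auto simp: eventually_at_filter dist_eq_D\<close>)
  then show "(h \<longlongrightarrow> h u) (at u within cap q r)" by (subst tendsto_dist_iff)
qed

text \<open>The radius is what matters: by \<open>patch_extend\<close>, every patch around a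
  preimage of \<open>x\<close> with a smaller positive radius enlarges to this one.\<close>

definition good :: "real \<Rightarrow> 'a \<Rightarrow> bool" where
  "good r x \<longleftrightarrow> (\<exists>q h. patch q h r \<and> h q = x)"

lemma exists_good: "\<exists>r>0. good r x"
proof -
  obtain e and f :: "'a \<Rightarrow> real ^ 3" where e: "e > 0" and fx: "f x \<in> model_sphere k"
    and im: "f ` ball x e = {q \<in> model_sphere k. model_dist k (f x) q < e}"
    and iso: "\<And>y z. y \<in> ball x e \<Longrightarrow> z \<in> ball x e \<Longrightarrow> model_dist k (f y) (f z) = dist y z"
    using surface unfolding constant_curvature_surface_def by (elim conjE allE[of _ x]) blast
  define g where "g y = sqrt k *\<^sub>R f y" for y
  \<comment> \<open>A chart goes from the surface to the sphere, a patch the other way; the inverse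
    exists because isometries are injective.\<close>
  define h where "h = inv_into (ball x e) g"
  define r where "r = sqrt k * e"
  have r: "r > 0" using e k_pos by (simp add: r_def)
  have ng: "norm (g y) = 1" if "y \<in> ball x e" for y
  proof -
    have "f y \<in> model_sphere k" using im that by blast
    then show ?thesis using k_pos by (simp add: g_def model_sphere_def)
  qed
  have md: "sqrt k * model_dist k u v = ang (sqrt k *\<^sub>R u) (sqrt k *\<^sub>R v)" for u v
    using k_pos by (simp add: model_dist_def ang_def mult.assoc[symmetric])
  have ag: "ang (g y) (g z) = D y z" if "y \<in> ball x e" "z \<in> ball x e" for y z
    using md[of "f y" "f z"] iso[OF that] by (simp add: g_def D_def)
  have xb: "x \<in> ball x e" using e by simp
  have gim: "u \<in> g ` ball x e" if u: "u \<in> cap (g x) r" for u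
  proof -
    let ?v = "(1 / sqrt k) *\<^sub>R u"
    have "sqrt k * model_dist k (f x) ?v < sqrt k * e"
      using md[of "f x" ?v] k_pos capD(2)[OF u] by (simp add: g_def r_def)
    then have "model_dist k (f x) ?v < e" using k_pos by simp
    moreover have "?v \<in> model_sphere k" using k_pos capD(1)[OF u] by (simp add: model_sphere_def)
    ultimately have "?v \<in> f ` ball x e" using im by blast
    then obtain y where "y \<in> ball x e" "?v = f y" by blast
    then show ?thesis using k_pos by (intro image_eqI[of _ _ y]) (auto simp: g_def simp flip: \<open>?v = f y\<close>)
  qed
  have h1: "h u \<in> ball x e" "g (h u) = u" if "u \<in> cap (g x) r" for u
    using gim[OF that] unfolding h_def by (rule inv_into_into, rule f_inv_into_f)
  have inj: "y = z" if "y \<in> ball x e" "z \<in> ball x e" "g y = g z" for y z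
    using ag[OF that(1,2)] that ang_self[OF ng[OF that(1)]] D_eq_0_iff by metis
  have gx: "g x \<in> cap (g x) r" using center_in_cap[OF ng[OF xb] r] .
  have hx: "h (g x) = x" using inj[OF h1(1)[OF gx] xb] h1(2)[OF gx] by simp
  have "patch (g x) h r"
    unfolding patch_def
  proof (intro conjI ballI allI impI)
    fix u v assume uv: "u \<in> cap (g x) r" "v \<in> cap (g x) r"
    show "D (h u) (h v) = ang u v"
      using ag[OF h1(1)[OF uv(1)] h1(1)[OF uv(2)]] h1(2)[OF uv(1)] h1(2)[OF uv(2)] by simp
  next
    fix y assume "D (h (g x)) y < r"
    then have D: "D x y < r" using hx by simp
    then have y: "y \<in> ball x e" using k_pos by (simp add: D_def r_def)
    have gy: "g y \<in> cap (g x) r" using D ag[OF xb y] ng[OF y] by (intro capI) auto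
    have "y = h (g y)" using inj[OF y h1(1)[OF gy]] h1(2)[OF gy] by simp
    then show "y \<in> h ` cap (g x) r" using gy by blast
  qed (rule ng[OF xb])
  then show ?thesis using r hx good_def by blast
qed

lemma good_near:
  assumes "good r x" "D x y + s \<le> r" "0 < s"
  shows "good s y"
proof -
  obtain q h where h: "patch q h r" "h q = x" using assms by (auto simp: good_def)
  obtain w where w: "w \<in> cap q r" "h w = y" using patch_onto[OF h(1), of y] assms h(2) by auto
  have "0 < r" using assms D_nonneg[of x y] by linarith
  then have "ang q w = D x y"
    using patch_D[OF h(1) center_in_cap w(1)] patch_norm[OF h(1)] h(2) w(2) by simp
  then have "patch w h s" using patch_subpatch[OF h(1) capD(1)[OF w(1)], of s] assms by simp
  then show ?thesis using w(2) good_def by blast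
qed

text \<open>On the small cap, \<open>h\<close> factors through the large patch \<open>j\<close> by
  an inner-product preserving map. This map extends to an orthogonal transformation
  \<open>A\<close>, and \<open>j \<circ> A\<close> is defined on the large cap.\<close>

lemma patch_extend:
  assumes h: "patch q h s" and s: "0 < s" "s \<le> r" and g: "good r (h q)"
  obtains h' where "patch q h' r" "\<And>w. w \<in> cap q s \<Longrightarrow> h' w = h w"
proof -
  obtain p j where j: "patch p j r" "j p = h q" using g by (auto simp: good_def)
  have q: "norm q = 1" and p: "norm p = 1" using h j by (auto simp: patch_def)
  have qc: "q \<in> cap q s" and pc: "p \<in> cap p r" using q p s by (auto intro: center_in_cap)
  have "\<exists>z. z \<in> cap p r \<and> j z = h w" if w: "w \<in> cap q s" for w
  proof -
    have "D (j p) (h w) < r" using patch_D[OF h qc w] j(2) capD(2)[OF w] s by simp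
    then show ?thesis using patch_onto[OF j(1)] by metis
  qed
  then obtain f where f: "\<And>w. w \<in> cap q s \<Longrightarrow> f w \<in> cap p r" "\<And>w. w \<in> cap q s \<Longrightarrow> j (f w) = h w"
    by metis
  have "f u \<bullet> f v = u \<bullet> v" if uv: "u \<in> cap q s" "v \<in> cap q s" for u v
  proof -
    have "ang (f u) (f v) = ang u v"
      using patch_D[OF j(1) f(1)[OF uv(1)] f(1)[OF uv(2)]] patch_D[OF h uv] f(2) uv by simp
    then show ?thesis using cos_ang uv f(1) by (metis capD(1))
  qed
  then obtain A where A: "orthogonal_transformation A" "\<And>w. w \<in> cap q s \<Longrightarrow> A w = f w"
    using inner_preserving_extend[OF span_cap[OF q s(1)], of f] by metis
  have ang_A: "ang (A u) (A v) = ang u v" and norm_A: "norm (A u) = norm u" for u v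
    using A(1) by (auto simp: ang_def orthogonal_transformation_def orthogonal_transformation_norm)
  have "ang p (f q) = 0" using patch_D[OF j(1) pc f(1)[OF qc]] f(2)[OF qc] j(2) D_self by simp
  then have Aq: "A q = p" using ang_eq_0_iff[OF p] A(2)[OF qc] f(1)[OF qc] capD(1) by metis
  have Ac: "A ` cap q r = cap p r"
  proof
    show "A ` cap q r \<subseteq> cap p r" using ang_A norm_A Aq by (auto simp: cap_def simp flip: Aq)
    show "cap p r \<subseteq> A ` cap q r"
    proof
      fix z assume z: "z \<in> cap p r"
      obtain w where w: "z = A w" using orthogonal_transformation_surj[OF A(1)] by (metis surjD)
      then have "w \<in> cap q r" using z ang_A[of q w] norm_A[of w] Aq by (simp add: cap_def)
      then show "z \<in> A ` cap q r" using w by blast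
    qed
  qed
  have "patch q (j \<circ> A) r"
    unfolding patch_def
  proof (intro conjI ballI allI impI)
    fix u v assume "u \<in> cap q r" "v \<in> cap q r"
    then have "A u \<in> cap p r" "A v \<in> cap p r" using Ac by auto
    then show "D ((j \<circ> A) u) ((j \<circ> A) v) = ang u v" using patch_D[OF j(1)] ang_A by simp
  next
    fix y assume "D ((j \<circ> A) q) y < r"
    then obtain z where "z \<in> cap p r" "j z = y" using patch_onto[OF j(1), of y] Aq by auto
    moreover from this obtain w where "w \<in> cap q r" "z = A w" using Ac by blast
    ultimately show "y \<in> (j \<circ> A) ` cap q r" by auto
  qed (rule q)
  then show thesis using A(2) f(2) by (intro that[of "j \<circ> A"]) auto
qed

section \<open>Compactness of closed balls\<close>

lemma exists_compact_cball: "\<exists>e>0. compact (cball (x::'a) e)"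
proof -
  obtain r where r: "r > 0" "good r x" using exists_good by blast
  then obtain q h where h: "patch q h r" "h q = x" by (auto simp: good_def)
  have q: "norm q = 1" using patch_norm[OF h(1)] .
  define C where "C = {w \<in> sphere 0 1. ang q w \<le> r / 2}"
  have sub: "C \<subseteq> cap q r" using r by (auto simp: C_def cap_def)
  have qc: "q \<in> cap q r" using center_in_cap[OF q r(1)] .
  have "continuous_on (sphere 0 1) (\<lambda>w. ang q w)"
    using q by (intro continuous_intros) auto
  then have "closedin (top_of_set (sphere 0 1)) (sphere 0 1 \<inter> ang q -` {..r/2})"
    by (rule continuous_closedin_preimage) simp
  then have "compact (sphere 0 1 \<inter> ang q -` {..r/2})" by (rule closedin_compact[rotated]) simp
  also have "sphere 0 1 \<inter> ang q -` {..r/2} = C" by (auto simp: C_def)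
  finally have "compact (h ` C)"
    using continuous_on_subset[OF patch_continuous[OF h(1)] sub] by (rule compact_continuous_image[rotated])
  also have "h ` C = cball x (r / 2 / sqrt k)"
  proof (intro equalityI subsetI)
    fix y assume "y \<in> h ` C"
    then obtain w where w: "w \<in> C" "y = h w" by blast
    then have "D x y \<le> r / 2" using patch_D[OF h(1) qc, of w] sub h(2) by (auto simp: C_def)
    then have "D x y / sqrt k \<le> r / 2 / sqrt k" using k_pos by (intro divide_right_mono) auto
    then show "y \<in> cball x (r / 2 / sqrt k)" by (simp add: dist_eq_D)
  next
    fix y assume "y \<in> cball x (r / 2 / sqrt k)"
    then have "D x y / sqrt k \<le> r / 2 / sqrt k" by (simp add: dist_eq_D)
    then have y: "D x y \<le> r / 2" using k_pos by (subst (asm) divide_le_cancel) auto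
    then obtain w where w: "w \<in> cap q r" "h w = y" using patch_onto[OF h(1), of y] h(2) r by auto
    then show "y \<in> h ` C" using patch_D[OF h(1) qc w(1)] h(2) y capD(1)[OF w(1)] by (auto simp: C_def)
  qed
  finally show ?thesis using r k_pos by (intro exI[of _ "r / 2 / sqrt k"]) auto
qed

text \<open>Makes the ball of radius \<open>R + d\<close> part of the closed
  \<open>d\<close>-neighbourhood of the ball of radius \<open>R\<close>: follow a geodesic from
  \<open>x\<close> for the length \<open>R\<close>.\<close>

lemma point_towards:
  assumes "dist (x::'a) y \<le> R + d" "0 \<le> R" "0 \<le> d"
  obtains z where "dist x z \<le> R" "dist z y \<le> d"
proof (cases "dist x y \<le> R")
  case True
  then show ?thesis using that[of y] assms by simp
next
  case False
  then have pos: "dist x y > 0" using assms by linarith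
  obtain g where g: "g 0 = x" "g 1 = y"
    "\<And>s t. s \<in> {0..1} \<Longrightarrow> t \<in> {0..1} \<Longrightarrow> dist (g s) (g t) = \<bar>s - t\<bar> * dist x y"
    using exists_geodesic[of x y] by blast
  let ?t = "R / dist x y"
  have t: "?t \<in> {0..1}" using False pos assms by (auto simp: divide_le_eq)
  have "dist x (g ?t) = R" using g(3)[of 0 ?t] t g(1) pos assms(2) by simp
  moreover have "dist (g ?t) y = dist x y - R" using g(3)[of ?t 1] t g(2) pos by (simp add: field_simps)
  ultimately show ?thesis using that[of "g ?t"] assms by simp
qed

lemma compact_cball_extend:
  assumes K: "compact (cball (x::'a) R)" and R: "0 \<le> R"
  shows "\<exists>d>0. compact (cball x (R + d))"
proof -
  obtain e where e: "\<And>y::'a. e y > 0" "\<And>y. compact (cball y (e y))"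
    using exists_compact_cball by metis
  have "cball x R \<subseteq> (\<Union>y\<in>cball x R. ball y (e y / 2))" using e by (auto intro!: bexI)
  then obtain Y where Y: "Y \<subseteq> cball x R" "finite Y" "cball x R \<subseteq> (\<Union>y\<in>Y. ball y (e y / 2))"
    using compactE_image[OF K, of "cball x R" "\<lambda>y. ball y (e y / 2)"] by auto
  have "x \<in> cball x R" using R by simp
  then have Yne: "Y \<noteq> {}" using Y(3) by blast
  \<comment> \<open>The half-radius balls cover the ball of radius \<open>R\<close>; a further
    distance \<open>d\<close> still stays within the balls of full radius.\<close>
  define d where "d = Min ((\<lambda>y. e y / 2) ` Y)"
  have "Min ((\<lambda>y. e y / 2) ` Y) \<le> e y / 2" if "y \<in> Y" for y
    using that Y(2) by (intro Min_le) auto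
  then have d: "d > 0" "\<And>y. y \<in> Y \<Longrightarrow> d \<le> e y / 2"
    using Y(2) Yne e by (auto simp: d_def)
  have "cball x (R + d) \<subseteq> (\<Union>y\<in>Y. cball y (e y))"
  proof
    fix z assume "z \<in> cball x (R + d)"
    then obtain w where w: "dist x w \<le> R" "dist w z \<le> d" using point_towards[of x z R d] R d by auto
    then obtain y where y: "y \<in> Y" "dist y w < e y / 2" using Y(3) by auto
    then have "dist y z \<le> e y" using dist_triangle[of y z w] w d(2)[OF y(1)] by linarith
    then show "z \<in> (\<Union>y\<in>Y. cball y (e y))" using y by auto
  qed
  moreover have "compact (\<Union>y\<in>Y. cball y (e y))" using Y(2) e(2) by (intro compact_UN) auto
  ultimately have "compact (cball x (R + d))" using compact_Int_closed[OF _ closed_cball[of x "R + d"]]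
    by (metis inf.absorb_iff2)
  then show ?thesis using d(1) by blast
qed

lemma compact_cball_limit:
  assumes K: "\<And>R'. 0 \<le> R' \<Longrightarrow> R' < R \<Longrightarrow> compact (cball (x::'a) R')" and R: "0 < R"
  shows "compact (cball x R)"
  unfolding compact_eq_totally_bounded
proof (intro conjI allI impI)
  have "complete (UNIV :: 'a set)" using surface by (simp add: constant_curvature_surface_def)
  then show "complete (cball x R)" using complete_Int_closed[OF _ closed_cball, of UNIV x R] by simp
  fix e :: real assume e: "e > 0"
  \<comment> \<open>A finite net of mesh \<open>e / 2\<close> for the ball of radius
    \<open>R'\<close> is a net of mesh \<open>e\<close> for the ball of radius
    \<open>R\<close>.\<close>
  define R' where "R' = max 0 (R - e / 2)"
  have R': "0 \<le> R'" "R' < R" "R \<le> R' + e / 2" using e R by (auto simp: R'_def)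
  then obtain Y where Y: "finite Y" "cball x R' \<subseteq> (\<Union>y\<in>Y. ball y (e / 2))"
    using K[of R'] e unfolding compact_eq_totally_bounded by (meson half_gt_zero)
  have "cball x R \<subseteq> (\<Union>y\<in>Y. ball y e)"
  proof
    fix z assume "z \<in> cball x R"
    then obtain w where w: "dist x w \<le> R'" "dist w z \<le> e / 2"
      using point_towards[of x z R' "e / 2"] R' e by auto
    then obtain y where y: "y \<in> Y" "dist y w < e / 2" using Y(2) by auto
    then have "dist y z < e" using dist_triangle[of y z w] w by linarith
    then show "z \<in> (\<Union>y\<in>Y. ball y e)" using y by auto
  qed
  then show "\<exists>Y. finite Y \<and> cball x R \<subseteq> (\<Union>y\<in>Y. ball y e)" using Y(1) by blast
qed

text \<open>The infimum of the radii with a non-compact ball has itself a compact ball by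
  \<open>compact_cball_limit\<close>, and \<open>compact_cball_extend\<close> then goes strictly
  beyond it, a contradiction.\<close>

lemma compact_cball: "compact (cball (x::'a) R)"
proof (rule ccontr)
  assume nc: "\<not> compact (cball x R)"
  define B where "B = {R. 0 \<le> R \<and> \<not> compact (cball x R)}"
  have mono: "compact (cball x s)" if "compact (cball x t)" "s \<le> t" for s t
    using compact_Int_closed[OF that(1) closed_cball[of x s]] that(2)
    by (metis inf.absorb_iff2 subset_cball)
  have "0 \<le> R" using nc by (cases "R < 0") auto
  then have ne: "R \<in> B" using nc by (simp add: B_def)
  have bd: "bdd_below B" by (rule bdd_belowI[of _ 0]) (auto simp: B_def)
  define m where "m = Inf B"
  have m0: "0 \<le> m" unfolding m_def using ne by (intro cInf_greatest) (auto simp: B_def)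
  have below: "compact (cball x s)" if "0 \<le> s" "s < m" for s
    using that cInf_lower[OF _ bd, of s] by (force simp: m_def B_def)
  have cm: "compact (cball x m)" using compact_cball_limit[OF below] m0 by (cases "m = 0") auto
  then obtain d where d: "d > 0" "compact (cball x (m + d))" using compact_cball_extend m0 by blast
  have "m + d \<le> m"
    unfolding m_def using ne
  proof (intro cInf_greatest)
    fix s assume "s \<in> B"
    then show "Inf B + d \<le> s" using mono[OF d(2), of s] by (force simp: B_def m_def)
  qed auto
  then show False using d(1) by simp
qed

text \<open>A chart of radius \<open>e y\<close> at \<open>y\<close> leaves charts of half that
  radius at all points within half of it, so finitely many \<open>y\<close> suffice. The cap at 1
  keeps the radii safely below pi.\<close>

lemma uniform_good:
  obtains r where "0 < r" "r \<le> 1" "\<And>y. D x y \<le> R \<Longrightarrow> good r y"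
proof (cases "0 \<le> R")
  case False
  then have "good 1 y" if "D x y \<le> R" for y using that D_nonneg[of x y] by linarith
  then show ?thesis using that[of 1] by simp
next
  case True
  obtain e where e: "\<And>y::'a. e y > 0" "\<And>y. good (e y) y" using exists_good by metis
  define K where "K = cball x (R / sqrt k)"
  define b where "b y = ball y (e y / 2 / sqrt k)" for y
  have K: "compact K" using compact_cball by (simp add: K_def)
  have "K \<subseteq> (\<Union>y\<in>K. b y)" using e k_pos by (auto intro!: bexI simp: b_def)
  then obtain Y where Y: "Y \<subseteq> K" "finite Y" "K \<subseteq> (\<Union>y\<in>Y. b y)"
    using compactE_image[OF K, of K b] by (auto simp: b_def)
  have "x \<in> K" using True k_pos by (simp add: K_def)
  then have Yne: "Y \<noteq> {}" using Y(3) by auto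
  define d where "d = min 1 (Min ((\<lambda>y. e y / 2) ` Y))"
  have d: "d > 0" "d \<le> 1" using Y(2) Yne e by (auto simp: d_def)
  have d3: "d \<le> e y / 2" if "y \<in> Y" for y
    unfolding d_def using that Y(2) by (intro min.coboundedI2 Min_le) auto
  show ?thesis
  proof (rule that[OF d(1,2)])
    fix z assume "D x z \<le> R"
    then have "z \<in> K" using k_pos by (simp add: K_def dist_eq_D divide_right_mono)
    then obtain y where y: "y \<in> Y" "z \<in> b y" using Y(3) by auto
    then have "D y z / sqrt k < e y / 2 / sqrt k" by (simp add: b_def dist_eq_D)
    then have "D y z < e y / 2" using k_pos by (subst (asm) divide_less_cancel) auto
    then show "good d z" using good_near[OF e(2)[of y], of z d] d(1) d3[OF y(1)] by simp
  qed
qed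

end

section \<open>The sphere covers the surface\<close>

lemma ang_minus_left:
  assumes "norm p = 1" "norm q = 1"
  shows "ang (- p) q = pi - ang p q"
  unfolding ang_def using inner_unit_bounds[OF assms] by (simp add: arccos_minus)

text \<open>Polar coordinates around \<open>p\<close> present the set as the image of an interval
  times a punctured hyperplane. The latter is connected because its dimension is at least 2.\<close>

lemma connected_punctured_cap:
  fixes p :: "'a::euclidean_space"
  assumes dim: "3 \<le> DIM('a)" and p: "norm p = 1" and r: "r \<le> pi"
  shows "connected (cap p r - {p})"
proof -
  define H where "H = {v. p \<bullet> v = 0} - {0}"
  have "p \<noteq> 0" using p by auto
  then have "aff_dim {v. p \<bullet> v = 0} = int DIM('a) - 1" by (simp add: aff_dim_hyperplane)
  then have "connected H"
    unfolding H_def using dim by (intro connected_punctured_convex convex_hyperplane) auto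
  then have "connected ({0<..<r} \<times> H)" by (intro connected_Times) auto
  moreover have "continuous_on ({0<..<r} \<times> H) (\<lambda>(t, v). great_arc p (v /\<^sub>R norm v) t)"
    unfolding great_arc_def case_prod_unfold H_def by (intro continuous_intros) auto
  ultimately have "connected ((\<lambda>(t, v). great_arc p (v /\<^sub>R norm v) t) ` ({0<..<r} \<times> H))"
    by (rule connected_continuous_image[rotated])
  also have "(\<lambda>(t, v). great_arc p (v /\<^sub>R norm v) t) ` ({0<..<r} \<times> H) = cap p r - {p}"
  proof (intro equalityI subsetI)
    fix z assume "z \<in> (\<lambda>(t, v). great_arc p (v /\<^sub>R norm v) t) ` ({0<..<r} \<times> H)"
    then obtain t v where tv: "0 < t" "t < r" "v \<in> H" "z = great_arc p (v /\<^sub>R norm v) t" by auto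
    then have v: "norm (v /\<^sub>R norm v) = 1" "p \<bullet> (v /\<^sub>R norm v) = 0" by (auto simp: H_def)
    have "ang p z = t" using ang_great_arc[OF p v, of 0 t] tv r by (simp add: great_arc_0)
    then show "z \<in> cap p r - {p}"
      using tv norm_great_arc[OF p v, of t] ang_self[OF p] by (auto simp: cap_def)
  next
    fix z assume z: "z \<in> cap p r - {p}"
    then have nz: "norm z = 1" "ang p z < r" "0 < ang p z"
      using ang_eq_0_iff[OF p, of z] ang_bounds(1)[OF p, of z] by (auto simp: cap_def)
    have d2: "2 \<le> DIM('a)" using dim by simp
    obtain u where u: "norm u = 1" "p \<bullet> u = 0" "z = great_arc p u (ang p z)"
      using exists_great_arc[OF d2 p nz(1)] by blast
    then have "u \<in> H" by (auto simp: H_def)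
    then show "z \<in> (\<lambda>(t, v). great_arc p (v /\<^sub>R norm v) t) ` ({0<..<r} \<times> H)"
      using nz u by (intro image_eqI[of _ _ "(ang p z, u)"]) auto
  qed
  finally show ?thesis .
qed

text \<open>Moves \<open>z\<close> along its meridian through \<open>n\<close>, multiplying the polar angle by \<open>c\<close>; meaningless
  at the poles, where \<open>sin (ang n z) = 0\<close>.\<close>

definition shrink :: "real \<Rightarrow> 'a::real_inner \<Rightarrow> 'a \<Rightarrow> 'a" where
  "shrink c n z = cos (c * ang n z) *\<^sub>R n
     + (sin (c * ang n z) / sin (ang n z)) *\<^sub>R (z - (n \<bullet> z) *\<^sub>R n)"

text \<open>In the form \<open>great_arc n u (ang n z)\<close> for \<open>z\<close>, shrinking
  multiplies the parameter by \<open>c\<close>. The defining formula expresses this without the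
  chosen \<open>u\<close>, so that continuity can be read off it.\<close>

lemma shrink:
  fixes n z :: "'a::euclidean_space"
  assumes dim: "2 \<le> DIM('a)" and n: "norm n = 1" and z: "norm z = 1"
    and t: "0 < ang n z" "ang n z < pi" and c: "0 \<le> c" "c \<le> 1"
  shows "norm (shrink c n z) = 1" "ang n (shrink c n z) = c * ang n z"
    "ang (shrink c n z) z = (1 - c) * ang n z"
proof -
  obtain u where u: "norm u = 1" "n \<bullet> u = 0" "z = great_arc n u (ang n z)"
    using exists_great_arc[OF dim n z] by blast
  have "sin (ang n z) > 0" using t by (rule sin_gt_zero)
  moreover have "z - (n \<bullet> z) *\<^sub>R n = sin (ang n z) *\<^sub>R u"
    using u(3) cos_ang[OF n z] by (simp add: great_arc_def algebra_simps)
  ultimately have eq: "shrink c n z = great_arc n u (c * ang n z)"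
    by (simp add: shrink_def great_arc_def)
  have ct: "0 \<le> c * ang n z" "c * ang n z \<le> ang n z" using c t by (auto intro: mult_left_le_one_le)
  show "norm (shrink c n z) = 1" using norm_great_arc[OF n u(1,2)] eq by simp
  show "ang n (shrink c n z) = c * ang n z"
    using ang_great_arc[OF n u(1,2), of 0 "c * ang n z"] ct t eq by (simp add: great_arc_0)
  have "ang (shrink c n z) (great_arc n u (ang n z)) = \<bar>c * ang n z - ang n z\<bar>"
    unfolding eq using ct t by (intro ang_great_arc[OF n u(1,2)]) auto
  then show "ang (shrink c n z) z = (1 - c) * ang n z"
    using u(3) ct by (simp add: algebra_simps)
qed

lemma continuous_on_shrink:
  assumes n: "norm n = 1"
  shows "continuous_on {z \<in> sphere 0 1. 0 < ang n z \<and> ang n z < pi} (shrink c n)"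
proof -
  have "sin (ang n z) \<noteq> 0" if "0 < ang n z" "ang n z < pi" for z
    using sin_gt_zero[OF that] by simp
  then show ?thesis unfolding shrink_def using n by (intro continuous_intros) auto
qed

context curved_surface
begin

text \<open>The value at \<open>z\<close> is read off a chart of the uniform radius \<open>r\<close> around the shrunken point.
  Since \<open>shrink\<close> is continuous, charts of neighbouring points agree, so the extended map is
  again locally isometric.\<close>

lemma exists_patch_off_poles:
  assumes h0: "patch n h0 r" and r: "0 < r" "r \<le> 1"
    and good: "\<And>y. D (h0 n) y \<le> pi \<Longrightarrow> good r y"
  shows "\<exists>F. \<forall>z\<in>sphere 0 1. 0 < ang n z \<and> ang n z < pi \<longrightarrow>
           (\<exists>e>0. patch z F e) \<and> D (h0 n) (F z) \<le> pi"
proof -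
  define x0 where "x0 = h0 n"
  have n: "norm n = 1" using patch_norm[OF h0] .
  \<comment> \<open>Polar angles are below pi, so one shrinking moves a point by less than
    \<open>r / 2\<close>.\<close>
  define c where "c = 1 - r / (2 * pi)"
  have rpi: "r < 2 * pi" using r pi_gt3 by linarith
  have c: "0 < c" "c < 1" "0 \<le> c" "c \<le> 1" using r rpi by (auto simp: c_def)
  have c1: "(1 - c) * t < r / 2" if "t < pi" for t using that r by (simp add: c_def field_simps)
  define A :: "(real ^ 3) set" where "A = {z \<in> sphere 0 1. 0 < ang n z \<and> ang n z < pi}"
  \<comment> \<open>The points brought into the base chart by \<open>j\<close> shrinkings. For
    \<open>j\<close> with \<open>c ^ j * pi < r\<close> this is the whole sphere without its
    poles.\<close>
  define W where "W j = {z \<in> A. c ^ j * ang n z < r}" for j :: nat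
  have contA: "continuous_on (sphere 0 1) (\<lambda>z. ang n z)" using n by (intro continuous_intros) auto
  have openA: "openin (top_of_set (sphere 0 1)) A"
  proof -
    have "openin (top_of_set (sphere 0 1)) (sphere 0 1 \<inter> ang n -` {0<..<pi})"
      using contA by (rule continuous_openin_preimage_gen) (rule open_greaterThanLessThan)
    also have "sphere 0 1 \<inter> ang n -` {0<..<pi} = A" by (auto simp: A_def)
    finally show ?thesis .
  qed
  have openW: "openin (top_of_set (sphere 0 1)) (W j)" for j
  proof -
    have "continuous_on (sphere 0 1) (\<lambda>z. c ^ j * ang n z)"
      using n by (intro continuous_intros) auto
    then have "openin (top_of_set (sphere 0 1)) (sphere 0 1 \<inter> (\<lambda>z. c ^ j * ang n z) -` {..<r})"
      by (rule continuous_openin_preimage_gen) simp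
    then have "openin (top_of_set (sphere 0 1)) (A \<inter> (sphere 0 1 \<inter> (\<lambda>z. c ^ j * ang n z) -` {..<r}))"
      using openA by (rule openin_Int[rotated])
    also have "A \<inter> (sphere 0 1 \<inter> (\<lambda>z. c ^ j * ang n z) -` {..<r}) = W j"
      by (auto simp: W_def A_def)
    finally show ?thesis .
  qed
  have sh: "norm (shrink c n z) = 1" "ang n (shrink c n z) = c * ang n z"
    "ang (shrink c n z) z = (1 - c) * ang n z" if "z \<in> A" for z
    using shrink[of n z c] n c that by (auto simp: A_def)
  have shW: "shrink c n z \<in> W j" if "z \<in> W (Suc j)" for z j
  proof -
    have z: "z \<in> A" "c ^ Suc j * ang n z < r" using that by (auto simp: W_def)
    have t: "0 < ang n z" "ang n z < pi" using z by (auto simp: A_def)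
    have "c * ang n z \<le> 1 * ang n z" using c t by (intro mult_right_mono) auto
    then have "0 < c * ang n z" "c * ang n z < pi" using c(1) t by (simp, linarith)
    then show ?thesis using sh[OF z(1)] z(2) by (simp add: W_def A_def mult.assoc mult.left_commute)
  qed
  \<comment> \<open>The distance bound is carried along to keep all values in the ball of radius pi,
    on which \<open>r\<close> is a uniform chart radius.\<close>
  have "\<exists>F. \<forall>z\<in>W j. (\<exists>e>0. patch z F e) \<and> D x0 (F z) \<le> ang n z" for j
  proof (induction j)
    case 0
    have "(\<exists>e>0. patch z h0 e) \<and> D x0 (h0 z) \<le> ang n z" if "z \<in> W 0" for z
    proof
      have z: "norm z = 1" "ang n z < r" using that by (auto simp: W_def A_def)
      show "\<exists>e>0. patch z h0 e"
        using patch_subpatch[OF h0 z(1), of "r - ang n z"] z(2) by (intro exI[of _ "r - ang n z"]) auto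
      show "D x0 (h0 z) \<le> ang n z"
        unfolding x0_def using patch_D[OF h0 center_in_cap[OF n r(1)] capI[OF z]] by simp
    qed
    then show ?case by blast
  next
    case (Suc j)
    then obtain F where F: "\<And>z. z \<in> W j \<Longrightarrow> \<exists>e>0. patch z F e"
      "\<And>z. z \<in> W j \<Longrightarrow> D x0 (F z) \<le> ang n z" by blast
    have "\<exists>e h. 0 < e \<and> patch q h r \<and> (\<forall>w\<in>cap q e. h w = F w)" if q: "q \<in> W j" for q
    proof -
      obtain e where e: "e > 0" "patch q F e" using F(1)[OF q] by blast
      have nq: "norm q = 1" using patch_norm[OF e(2)] .
      have "patch q F (min e r)" using patch_subpatch[OF e(2) nq, of "min e r"] ang_self[OF nq] by simp
      moreover have "good r (F q)"
        using good F(2)[OF q] ang_bounds(2)[OF n nq] by (simp add: x0_def)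
      ultimately obtain h where "patch q h r" "\<And>w. w \<in> cap q (min e r) \<Longrightarrow> h w = F w"
        using patch_extend[of q F "min e r" r] e(1) r(1) by auto
      then show ?thesis using e(1) r(1) by (intro exI[of _ "min e r"] exI[of _ h]) auto
    qed
    then obtain e H where e: "\<And>q. q \<in> W j \<Longrightarrow> 0 < e q"
      and H: "\<And>q. q \<in> W j \<Longrightarrow> patch q (H q) r"
      and HF: "\<And>q w. q \<in> W j \<Longrightarrow> w \<in> cap q (e q) \<Longrightarrow> H q w = F w"
      by metis
    define G where "G z = H (shrink c n z) z" for z
    have "(\<exists>e>0. patch z G e) \<and> D x0 (G z) \<le> ang n z" if z: "z \<in> W (Suc j)" for z
    proof
      define q where "q = shrink c n z"
      have q: "q \<in> W j" using shW[OF z] by (simp add: q_def)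
      have zA: "z \<in> A" using z by (simp add: W_def)
      have nz: "norm z = 1" "ang n z < pi" using zA by (auto simp: A_def)
      have nq: "norm q = 1" using sh(1)[OF zA] by (simp add: q_def)
      have qz: "ang q z < r / 2" using sh(3)[OF zA] c1[OF nz(2)] by (simp add: q_def)
      define s where "s = min (e q) (r / 2)"
      have s: "0 < s" using e[OF q] r by (simp add: s_def)
      \<comment> \<open>The points whose shrunken point is so close to \<open>q\<close> that the
        patches read off there can be compared with \<open>H q\<close>.\<close>
      define U where "U = A \<inter> shrink c n -` (W j \<inter> cap q s)"
      have "openin (top_of_set A) U"
        unfolding U_def
      proof (rule continuous_openin_preimage)
        show "continuous_on A (shrink c n)" unfolding A_def by (rule continuous_on_shrink[OF n])
        show "shrink c n \<in> A \<rightarrow> sphere 0 1" using sh(1) by auto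
        show "openin (top_of_set (sphere 0 1)) (W j \<inter> cap q s)" using openW openin_cap[OF nq] by blast
      qed
      then have openU: "openin (top_of_set (sphere 0 1)) U" using openA openin_trans by blast
      have "z \<in> U" using zA q center_in_cap[OF nq s] by (simp add: U_def q_def[symmetric])
      then obtain d where d: "0 < d" "cap z d \<subseteq> U" using cap_in_openin[OF openU] by blast
      define d' where "d' = min d (r / 2)"
      have Hq: "patch z (H q) d'" using patch_subpatch[OF H[OF q] nz(1), of d'] qz by (simp add: d'_def)
      have "G w = H q w" if w: "w \<in> cap z d'" for w
      proof -
        define p where "p = shrink c n w"
        have "w \<in> U" using w d(2) by (auto simp: d'_def cap_def)
        then have wA: "w \<in> A" and p: "p \<in> W j" "p \<in> cap q s" by (auto simp: U_def p_def)
        have nw: "norm w = 1" "ang n w < pi" using wA by (auto simp: A_def)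
        have np: "norm p = 1" using capD(1)[OF p(2)] .
        have qp: "ang q p < e q" "ang q p < r / 2" using capD(2)[OF p(2)] by (auto simp: s_def)
        have P1: "patch p (H p) (r / 2)" using patch_subpatch[OF H[OF p(1)] np, of "r / 2"] ang_self[OF np] r by simp
        have P2: "patch p (H q) (r / 2)" using patch_subpatch[OF H[OF q] np, of "r / 2"] qp(2) by simp
        \<comment> \<open>On this cap around \<open>p\<close> both \<open>H p\<close> and
          \<open>H q\<close> equal the old \<open>F\<close>; \<open>patch_agree\<close> carries the
          equality to radius \<open>r / 2\<close>, which reaches \<open>w\<close>.\<close>
        define b where "b = min (e p) (e q - ang q p)"
        have "H p v = H q v" if "v \<in> cap p b" for v
        proof -
          have "v \<in> cap p (e p)" using that by (simp add: cap_def b_def)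
          moreover have "cap p b \<subseteq> cap q (e q)" by (rule cap_subset_cap[OF np nq]) (simp add: b_def)
          then have "v \<in> cap q (e q)" using that by blast
          ultimately show ?thesis using HF[OF p(1)] HF[OF q] by simp
        qed
        moreover have "w \<in> cap p (r / 2)"
          using sh(3)[OF wA] c1[OF nw(2)] nw(1) by (intro capI) (auto simp: p_def)
        moreover have "0 < b" using e[OF p(1)] qp(1) by (simp add: b_def)
        ultimately have "H p w = H q w" using patch_agree[OF P1 P2] by blast
        then show ?thesis by (simp add: G_def p_def)
      qed
      moreover have "0 < d'" using d(1) r by (simp add: d'_def)
      ultimately show "\<exists>e>0. patch z G e" using patch_cong[OF Hq] by blast
      have "D (H q q) (H q z) = ang q z"
        using patch_D[OF H[OF q] center_in_cap[OF nq r(1)] capI[OF nz(1)]] qz r by simp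
      moreover have "H q q = F q" using HF[OF q center_in_cap[OF nq e[OF q]]] .
      ultimately have "D x0 (G z) \<le> ang n q + ang q z"
        using D_triangle[of x0 "H q z" "F q"] F(2)[OF q] by (simp add: G_def flip: q_def)
      also have "\<dots> = ang n z" using sh[OF zA] by (simp add: q_def algebra_simps)
      finally show "D x0 (G z) \<le> ang n z" .
    qed
    then show ?case by blast
  qed
  moreover obtain j where "c ^ j < r / pi" using real_arch_pow_inv[of "r / pi" c] r c by auto
  then have j: "c ^ j * pi < r" by (simp add: field_simps)
  have "W j = A"
  proof -
    have "c ^ j * ang n z < r" if "z \<in> A" for z
    proof -
      have "c ^ j * ang n z \<le> c ^ j * pi" using that c by (intro mult_left_mono) (auto simp: A_def)
      then show ?thesis using j by linarith
    qed
    then show ?thesis by (auto simp: W_def)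
  qed
  ultimately obtain F where "\<And>z. z \<in> A \<Longrightarrow> (\<exists>e>0. patch z F e) \<and> D x0 (F z) \<le> ang n z" by metis
  then show ?thesis unfolding A_def x0_def
    by (intro exI[of _ F]) force
qed

text \<open>Start with a full-size patch \<open>h\<close> that agrees with \<open>F\<close> near one
  point of the punctured cap. Agreement spreads over the punctured cap because that is connected,
  and \<open>h\<close> is also a patch around the missing centre.\<close>

lemma patch_fill_puncture:
  assumes p: "norm p = 1" and r: "0 < r" "r \<le> 1"
    and F: "\<And>z. z \<in> cap p (r / 2) - {p} \<Longrightarrow> (\<exists>e>0. patch z F e) \<and> good r (F z)"
  shows "\<exists>h. patch p h (r / 2) \<and> (\<forall>w\<in>cap p (r / 2) - {p}. F w = h w)"
proof -
  define V where "V = cap p (r / 2) - {p}"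
  have rpi: "r / 2 \<le> pi" using r pi_gt3 by linarith
  have "connected V"
    unfolding V_def using p rpi by (intro connected_punctured_cap) auto
  obtain u where u: "norm u = 1" "p \<bullet> u = 0" using exists_unit_orthogonal[of p] by auto
  define q where "q = great_arc p u (r / 4)"
  have nq: "norm q = 1" using norm_great_arc[OF p u] by (simp add: q_def)
  have "ang p q = r / 4" using ang_great_arc[OF p u, of 0 "r / 4"] r rpi by (simp add: q_def great_arc_0)
  then have q: "q \<in> V" using nq r ang_self[OF p] by (auto simp: V_def cap_def)
  obtain e where e: "e > 0" "patch q F e" using F q unfolding V_def by blast
  have "patch q F (min e r)" using patch_subpatch[OF e(2) nq, of "min e r"] ang_self[OF nq] by simp
  then obtain h where h: "patch q h r" "\<And>w. w \<in> cap q (min e r) \<Longrightarrow> h w = F w"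
    using patch_extend[of q F "min e r" r] e(1) r(1) F q unfolding V_def by auto
  define agree where "agree z \<longleftrightarrow> (\<exists>d>0. \<forall>w\<in>cap z d. F w = h w)" for z
  have V: "norm z = 1" "ang q z < r" if "z \<in> V" for z
  proof -
    show nz: "norm z = 1" using that by (simp add: V_def cap_def)
    show "ang q z < r" using ang_triangle[OF nq p nz] capD(2)[of q p "r/2"] capD(2)[of z p "r/2"] q that
      by (auto simp: V_def ang_commute)
  qed
  have agV: "agree z" if z: "z \<in> V" for z
  proof (rule connected_induction_simple[OF \<open>connected V\<close> q z])
    show "agree q" unfolding agree_def using h(2) e(1) r(1) by (intro exI[of _ "min e r"]) auto
    fix a assume a: "a \<in> V"
    obtain d where d: "d > 0" "patch a F d" using F a unfolding V_def by blast
    define s where "s = min d (r - ang q a)"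
    have s: "s > 0" using d(1) V(2)[OF a] by (simp add: s_def)
    have na: "norm a = 1" using V(1)[OF a] .
    have P: "patch a F s" "patch a h s"
      using patch_subpatch[OF d(2) na, of s] patch_subpatch[OF h(1) na, of s] ang_self[OF na] by (auto simp: s_def)
    \<comment> \<open>Within \<open>s / 4\<close> of \<open>a\<close> both maps are patches of
      radius \<open>3 * s / 4\<close>. Agreement near \<open>x\<close> thus extends to that radius,
      and since \<open>x\<close> and \<open>y\<close> are less than \<open>s / 2\<close> apart, to
      the \<open>s / 4\<close>-cap around \<open>y\<close>.\<close>
    show "\<exists>T. openin (top_of_set V) T \<and> a \<in> T \<and> (\<forall>x\<in>T. \<forall>y\<in>T. agree x \<longrightarrow> agree y)"
    proof (intro exI conjI ballI impI)
      obtain O' where "open O'" "cap a (s / 4) = sphere 0 1 \<inter> O'"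
        using openin_cap[OF na] by (metis openin_open)
      moreover have "V \<subseteq> sphere 0 1" by (auto simp: V_def cap_def)
      ultimately show "openin (top_of_set V) (V \<inter> cap a (s / 4))"
        by (simp add: openin_open) blast
      show "a \<in> V \<inter> cap a (s / 4)" using a center_in_cap[OF na] s by simp
      fix x y assume x: "x \<in> V \<inter> cap a (s / 4)" and y: "y \<in> V \<inter> cap a (s / 4)" and "agree x"
      then obtain b where b: "b > 0" "\<And>w. w \<in> cap x b \<Longrightarrow> F w = h w" by (auto simp: agree_def)
      have nx: "norm x = 1" and ny: "norm y = 1" using V(1) x y by auto
      have ax: "ang a x < s / 4" and ay: "ang a y < s / 4" using x y by (auto simp: cap_def)
      have xy: "ang x y < s / 2" using ang_triangle[OF nx na ny] ax ay by (simp add: ang_commute)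
      have P': "patch x F (3 * s / 4)" "patch x h (3 * s / 4)"
        using patch_subpatch[OF P(1) nx, of "3 * s / 4"] patch_subpatch[OF P(2) nx, of "3 * s / 4"] ax by auto
      have "F w = h w" if "w \<in> cap x (3 * s / 4)" for w
        using patch_agree[OF P' b that] .
      then show "agree y"
        unfolding agree_def using s cap_subset_cap[OF ny nx, of "s / 4" "3 * s / 4"] xy
        by (intro exI[of _ "s / 4"]) auto
    qed
  qed
  have "F w = h w" if "w \<in> V" for w
    using agV[OF that] center_in_cap V(1)[OF that] by (auto simp: agree_def)
  moreover have "patch p h (r / 2)"
    using patch_subpatch[OF h(1) p, of "r / 2"] \<open>ang p q = r / 4\<close> r by (simp add: ang_commute)
  ultimately show ?thesis unfolding V_def by blast
qed

text \<open>Meridians have no well-defined direction at the poles, so the map is repaired there by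
  filling the two punctures. At \<open>- n\<close> this shows that continuation along all meridians
  ends at the same value.\<close>

lemma exists_locally_patch: "\<exists>F. \<forall>z\<in>sphere 0 1. \<exists>e>0. patch z F e"
proof -
  \<comment> \<open>An arbitrary base point; it only serves to start the continuation.\<close>
  define x0 :: 'a where "x0 = undefined"
  obtain r where r: "0 < r" "r \<le> 1" "\<And>y. D x0 y \<le> pi \<Longrightarrow> good r y" using uniform_good[of x0 pi] by blast
  then have "good r x0" using D_self by simp
  then obtain n h0 where h0: "patch n h0 r" "h0 n = x0" by (auto simp: good_def)
  have n: "norm n = 1" and n': "norm (- n) = 1" using patch_norm[OF h0(1)] by auto
  obtain F where "\<forall>z\<in>sphere 0 1. 0 < ang n z \<and> ang n z < pi \<longrightarrow>
           (\<exists>e>0. patch z F e) \<and> D (h0 n) (F z) \<le> pi"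
    using exists_patch_off_poles[OF h0(1) r(1,2)] r(3) h0(2) by auto
  moreover have "0 < ang n z \<and> ang n z < pi \<longleftrightarrow> z \<noteq> n \<and> z \<noteq> - n" if "norm z = 1" for z
    using ang_eq_0_iff[OF n that] ang_eq_0_iff[OF n' that] ang_minus_left[OF n that]
      ang_bounds[OF n that] by auto
  ultimately have F: "\<And>z. norm z = 1 \<Longrightarrow> z \<noteq> n \<Longrightarrow> z \<noteq> - n \<Longrightarrow> (\<exists>e>0. patch z F e) \<and> good r (F z)"
    using r(3) h0(2) by auto
  have antip: "ang n (- n) = pi" "ang (- n) n = pi"
    using ang_minus_left[OF n n] ang_self[OF n] by (auto simp: ang_commute)
  have "ang n (- n) \<noteq> ang n n" using antip ang_self[OF n] by simp
  then have nn: "n \<noteq> - n" by metis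
  have r2: "r / 2 < pi" using r pi_gt3 by linarith
  have F1: "\<exists>e>0. patch z F e" "good r (F z)" if z: "z \<in> cap n (r / 2) - {n}" for z
  proof -
    have "z \<noteq> - n" using z antip(1) r2 by (auto simp: cap_def)
    then show "\<exists>e>0. patch z F e" "good r (F z)" using F[of z] z by (auto simp: cap_def)
  qed
  obtain h1 where h1: "patch n h1 (r / 2)" "\<And>w. w \<in> cap n (r / 2) - {n} \<Longrightarrow> F w = h1 w"
    using patch_fill_puncture[OF n r(1,2), of F] F1 by blast
  have F2: "\<exists>e>0. patch z F e" "good r (F z)" if z: "z \<in> cap (- n) (r / 2) - {- n}" for z
  proof -
    have "z \<noteq> n" using z antip(2) r2 by (auto simp: cap_def)
    then show "\<exists>e>0. patch z F e" "good r (F z)" using F[of z] z by (auto simp: cap_def)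
  qed
  obtain h2 where h2: "patch (- n) h2 (r / 2)" "\<And>w. w \<in> cap (- n) (r / 2) - {- n} \<Longrightarrow> F w = h2 w"
    using patch_fill_puncture[OF n' r(1,2), of F] F2 by blast
  define G where "G = F(n := h1 n, - n := h2 (- n))"
  have "\<exists>e>0. patch z G e" if z: "norm z = 1" for z
  proof -
    consider "z = n" | "z = - n" | "z \<noteq> n" "z \<noteq> - n" by blast
    then show ?thesis
    proof cases
      case 1
      have "G w = h1 w" if "w \<in> cap n (r / 2)" for w
        using h1(2)[of w] that nn antip r2 by (auto simp: G_def cap_def)
      then have "patch n G (r / 2)" using patch_cong[OF h1(1)] r(1) by simp
      then show ?thesis using 1 r(1) half_gt_zero by blast
    next
      case 2
      have "G w = h2 w" if "w \<in> cap (- n) (r / 2)" for w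
        using h2(2)[of w] that nn antip r2 by (auto simp: G_def cap_def)
      then have "patch (- n) G (r / 2)" using patch_cong[OF h2(1)] r(1) by simp
      then show ?thesis using 2 r(1) half_gt_zero by blast
    next
      case 3
      then obtain e where e: "e > 0" "patch z F e" using F z by blast
      define d where "d = min e (min (ang z n) (ang z (- n)))"
      have "ang z n > 0" "ang z (- n) > 0"
        using 3 ang_eq_0_iff[OF z n] ang_eq_0_iff[OF z n'] ang_bounds(1)[OF z n] ang_bounds(1)[OF z n'] by auto
      then have d: "d > 0" using e(1) by (simp add: d_def)
      have "G w = F w" if "w \<in> cap z d" for w
        using that by (auto simp: G_def cap_def d_def)
      moreover have "patch z F d" using patch_subpatch[OF e(2) z, of d] ang_self[OF z] by (simp add: d_def)
      ultimately show ?thesis using patch_cong d by blast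
    qed
  qed
  then show ?thesis by (intro exI[of _ G]) auto
qed

text \<open>A Lebesgue number argument on the compact sphere; paths can then be subdivided into
  steps of one fixed size.\<close>

lemma exists_covering:
  obtains F d where "0 < d" "\<And>z. norm z = 1 \<Longrightarrow> patch z F d"
proof -
  obtain F e where e: "\<And>z. norm z = 1 \<Longrightarrow> 0 < e z" "\<And>z. norm z = 1 \<Longrightarrow> patch z F (e z)"
    using exists_locally_patch by (metis mem_sphere_0)
  have "\<exists>U. open U \<and> cap z (e z / 2) = sphere 0 1 \<inter> U" if "norm z = 1" for z
    using openin_cap[OF that, of "e z / 2"] by (simp add: openin_open)
  then obtain U where U: "\<And>z. norm z = 1 \<Longrightarrow> open (U z)"
    "\<And>z. norm z = 1 \<Longrightarrow> cap z (e z / 2) = sphere 0 1 \<inter> U z" by metis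
  have "z \<in> U z" if "norm z = 1" for z
    using U(2)[OF that] center_in_cap[OF that, of "e z / 2"] e(1)[OF that] by auto
  then have cover: "sphere 0 1 \<subseteq> (\<Union>z\<in>sphere 0 1. U z)" by auto
  obtain Y where Y: "Y \<subseteq> sphere 0 1" "finite Y" "sphere 0 1 \<subseteq> (\<Union>z\<in>Y. U z)"
    by (rule compactE_image[OF compact_sphere _ cover]) (use U(1) in auto)
  have "axis 1 1 \<in> (sphere 0 1 :: (real ^ 3) set)" by (simp add: norm_axis_1)
  then have Yne: "Y \<noteq> {}" using Y(3) by blast
  define d where "d = Min ((\<lambda>y. e y / 2) ` Y)"
  have d: "d \<le> e y / 2" if "y \<in> Y" for y
    unfolding d_def using that Y(2) by (intro Min_le) auto
  have "d > 0" unfolding d_def using Y(1,2) Yne e(1) by auto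
  moreover have "patch z F d" if z: "norm z = 1" for z
  proof -
    obtain y where y: "y \<in> Y" "z \<in> U y" using Y(3) z by auto
    have ny: "norm y = 1" using y(1) Y(1) by auto
    have "z \<in> cap y (e y / 2)" using U(2)[OF ny] y(2) z by auto
    then have "ang y z < e y / 2" by (rule capD)
    then show ?thesis using patch_subpatch[OF e(2)[OF ny] z, of d] d[OF y(1)] by simp
  qed
  ultimately show ?thesis using that by blast
qed

section \<open>Metric properties of the covering\<close>

lemma covering_lipschitz:
  assumes d: "0 < d" and F: "\<And>z. norm z = 1 \<Longrightarrow> patch z F d"
    and a: "norm a = 1" and b: "norm b = 1"
  shows "D (F a) (F b) \<le> ang a b"
proof -
  obtain u where u: "norm u = 1" "a \<bullet> u = 0" "b = great_arc a u (ang a b)"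
    using exists_great_arc[OF _ a b] by auto
  obtain N :: nat where N: "ang a b / d < N" using reals_Archimedean2 by blast
  define t where "t = ang a b / N"
  \<comment> \<open>The arc is cut into \<open>N\<close> steps shorter than \<open>d\<close>; each
    step lies in one patch and keeps its length.\<close>
  have ab: "0 \<le> ang a b" "ang a b \<le> pi" using ang_bounds[OF a b] by auto
  have "0 \<le> ang a b / d" using ab d by simp
  then have Npos: "0 < N" using N by linarith
  have t: "0 \<le> t" "t < d" "N * t = ang a b"
    using N Npos d ab by (auto simp: t_def field_simps)
  have "t * 1 \<le> t * N" using t(1) Npos by (intro mult_left_mono) auto
  then have tpi: "t \<le> pi" using t(3) ab by (simp add: mult.commute)
  define c where "c i = great_arc a u (real i * t)" for i :: nat
  have nc: "norm (c i) = 1" for i using norm_great_arc[OF a u(1,2)] by (simp add: c_def)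
  have "D (F a) (F (c i)) \<le> i * t" for i
  proof (induction i)
    case 0
    then show ?case by (simp add: c_def great_arc_0 D_self)
  next
    case (Suc i)
    have "ang (c i) (c (Suc i)) = \<bar>real i * t - real (Suc i) * t\<bar>"
      unfolding c_def using t tpi by (intro ang_great_arc[OF a u(1,2)]) (simp add: algebra_simps)
    also have "\<dots> = t" using t by (simp add: algebra_simps)
    finally have "D (F (c i)) (F (c (Suc i))) = t"
      using patch_D[OF F[OF nc] center_in_cap[OF nc d] capI[OF nc]] t by simp
    then show ?case using D_triangle[of "F a" "F (c (Suc i))" "F (c i)"] Suc by (simp add: algebra_simps)
  qed
  from this[of N] show ?thesis using t u(3) by (simp add: c_def)
qed

text \<open>Path lifting: a shortest geodesic is cut into pieces shorter than \<open>d\<close>, and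
  each end point is lifted by the surjectivity of a patch onto its ball. The lifted steps have the
  same length, whence the bound.\<close>

lemma covering_lift:
  assumes d: "0 < d" and F: "\<And>z. norm z = 1 \<Longrightarrow> patch z F d" and a: "norm a = 1"
  obtains b where "norm b = 1" "F b = y" "ang a b \<le> D (F a) y"
proof -
  obtain g where g: "g 0 = F a" "g 1 = y"
    "\<And>s t. s \<in> {0..1} \<Longrightarrow> t \<in> {0..1} \<Longrightarrow> dist (g s) (g t) = \<bar>s - t\<bar> * dist (F a) y"
    using exists_geodesic[of "F a" y] by blast
  define L where "L = D (F a) y"
  obtain N :: nat where N: "L / d < N" using reals_Archimedean2 by blast
  have L: "0 \<le> L" using D_nonneg by (simp add: L_def)
  then have "0 \<le> L / d" using d by simp
  then have Npos: "0 < N" using N by linarith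
  have Ld: "L / N < d" using N Npos d by (simp add: field_simps)
  have "\<exists>b. norm b = 1 \<and> F b = g (i / N) \<and> ang a b \<le> i * (L / N)" if "i \<le> N" for i
    using that
  proof (induction i)
    case 0
    then show ?case using a g(1) ang_self[OF a] by auto
  next
    case (Suc i)
    then obtain b where b: "norm b = 1" "F b = g (i / N)" "ang a b \<le> i * (L / N)" by auto
    have "real i / N \<in> {0..1}" "real (Suc i) / N \<in> {0..1}" using Suc.prems Npos by auto
    then have "dist (g (i / N)) (g (Suc i / N)) = \<bar>i / N - Suc i / N\<bar> * dist (F a) y" by (rule g(3))
    also have "\<bar>i / N - Suc i / N\<bar> = 1 / N" by (simp add: diff_divide_distrib[symmetric])
    finally have D: "D (F b) (g (Suc i / N)) = L / N" using b(2) by (simp add: D_def L_def)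
    then obtain w where w: "w \<in> cap b d" "F w = g (Suc i / N)" using patch_onto[OF F[OF b(1)]] Ld by metis
    have "ang b w = L / N" using patch_D[OF F[OF b(1)] center_in_cap[OF b(1) d] w(1)] w(2) D by simp
    then have "ang a w \<le> Suc i * (L / N)"
      using ang_triangle[OF a b(1) capD(1)[OF w(1)]] b(3) by (simp add: algebra_simps add_divide_distrib)
    then show ?case using w capD(1) by blast
  qed
  from this[of N] obtain b where "norm b = 1" "F b = g 1" "ang a b \<le> L" using Npos by auto
  then show ?thesis using that g(2) by (simp add: L_def)
qed

lemma covering_continuous:
  assumes d: "0 < d" and F: "\<And>z. norm z = 1 \<Longrightarrow> patch z F d"
  shows "continuous_on (sphere 0 1) F"
  unfolding continuous_on_def
proof
  fix u :: "real ^ 3" assume u: "u \<in> sphere 0 1"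
  have "continuous_on (sphere 0 1) (\<lambda>v. ang v u / sqrt k)"
    using k_pos u by (intro continuous_intros) auto
  then have "((\<lambda>v. ang v u / sqrt k) \<longlongrightarrow> ang u u / sqrt k) (at u within sphere 0 1)"
    using u by (auto simp: continuous_on_def)
  then have lim: "((\<lambda>v. ang v u / sqrt k) \<longlongrightarrow> 0) (at u within sphere 0 1)"
    using u by (simp add: ang_self)
  have "dist (F v) (F u) \<le> ang v u / sqrt k" if "norm v = 1" for v
    using covering_lipschitz[OF d F that] u k_pos by (simp add: dist_eq_D divide_right_mono)
  then have "((\<lambda>v. dist (F v) (F u)) \<longlongrightarrow> 0) (at u within sphere 0 1)"
    by (intro tendsto_sandwich[OF _ _ tendsto_const lim]) (auto simp: eventually_at_filter)
  then show "(F \<longlongrightarrow> F u) (at u within sphere 0 1)" by (subst tendsto_dist_iff)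
qed

text \<open>Lifting a shortest geodesic from \<open>F a\<close> to \<open>F b\<close> ends at a
  preimage of \<open>F b\<close>, which is \<open>b\<close> by injectivity. This gives the
  inequality opposite to \<open>covering_lipschitz\<close>.\<close>

lemma covering_inj_isometry:
  assumes d: "0 < d" and F: "\<And>z. norm z = 1 \<Longrightarrow> patch z F d" and inj: "inj_on F (sphere 0 1)"
  shows "F ` sphere 0 1 = UNIV"
    and "norm a = 1 \<Longrightarrow> norm b = 1 \<Longrightarrow> D (F a) (F b) = ang a b"
proof -
  show "F ` sphere 0 1 = UNIV"
  proof (intro equalityI subsetI)
    fix y
    have "norm (axis 1 1 :: real ^ 3) = 1" by (simp add: norm_axis_1)
    then obtain b where "norm b = 1" "F b = y" using covering_lift[OF d F] by blast
    then show "y \<in> F ` sphere 0 1" by auto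
  qed simp
  assume a: "norm a = 1" and b: "norm b = 1"
  obtain c where c: "norm c = 1" "F c = F b" "ang a c \<le> D (F a) (F b)"
    using covering_lift[OF d F a] by blast
  then have "c = b" using inj_onD[OF inj] b by simp
  then show "D (F a) (F b) = ang a b" using c(3) covering_lipschitz[OF d F a b] by simp
qed

text \<open>A shortest pair identified by the covering closes up to a geodesic loop in which any two
  opposite points have both quarter points as midpoints.\<close>

lemma covering_not_inj_midpoints:
  assumes d: "0 < d" and F: "\<And>z. norm z = 1 \<Longrightarrow> patch z F d" and ninj: "\<not> inj_on F (sphere 0 1)"
  obtains p q m1 m2 :: 'a where "m1 \<noteq> m2" "dist p q \<le> pi / 2 / sqrt k"
    "dist p m1 = dist p q / 2" "dist m1 q = dist p q / 2"
    "dist p m2 = dist p q / 2" "dist m2 q = dist p q / 2"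
proof -
  let ?S = "sphere 0 1 :: (real ^ 3) set"
  have far: "d \<le> ang a b" if "norm a = 1" "norm b = 1" "F a = F b" "a \<noteq> b" for a b
  proof (rule ccontr)
    assume "\<not> d \<le> ang a b"
    then have "D (F a) (F b) = ang a b"
      using patch_D[OF F[OF that(1)] center_in_cap[OF that(1) d] capI[OF that(2)]] by simp
    then show False using that D_self ang_eq_0_iff[of a b] by simp
  qed
  \<comment> \<open>Identified pairs are at least \<open>d\<close> apart, so this closed condition
    removes just the diagonal and leaves a compact set on which the angle attains its
    minimum.\<close>
  define C where "C = {x \<in> ?S \<times> ?S. F (fst x) = F (snd x) \<and> d \<le> ang (fst x) (snd x)}"
  have cF: "continuous_on ?S F" using covering_continuous[OF d F] .
  have c1: "continuous_on (?S \<times> ?S) (\<lambda>x. dist (F (fst x)) (F (snd x)))"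
    by (intro continuous_intros continuous_on_compose2[OF cF]) auto
  have c2: "continuous_on (?S \<times> ?S) (\<lambda>x. ang (fst x) (snd x))"
    by (intro continuous_intros) auto
  have "closedin (top_of_set (?S \<times> ?S)) ((?S \<times> ?S \<inter> (\<lambda>x. dist (F (fst x)) (F (snd x))) -` {0})
      \<inter> (?S \<times> ?S \<inter> (\<lambda>x. ang (fst x) (snd x)) -` {d..}))"
    by (intro closedin_Int continuous_closedin_preimage c1 c2) auto
  also have "(?S \<times> ?S \<inter> (\<lambda>x. dist (F (fst x)) (F (snd x))) -` {0})
      \<inter> (?S \<times> ?S \<inter> (\<lambda>x. ang (fst x) (snd x)) -` {d..}) = C"
    by (auto simp: C_def)
  finally have compC: "compact C" by (rule closedin_compact[rotated]) (intro compact_Times compact_sphere)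
  obtain a0 b0 where "norm a0 = 1" "norm b0 = 1" "F a0 = F b0" "a0 \<noteq> b0"
    using ninj by (auto simp: inj_on_def)
  then have "(a0, b0) \<in> C" using far by (simp add: C_def)
  then have "C \<noteq> {}" by blast
  moreover have "C \<subseteq> ?S \<times> ?S" by (auto simp: C_def)
  ultimately obtain x where x: "x \<in> C" "\<And>y. y \<in> C \<Longrightarrow> ang (fst x) (snd x) \<le> ang (fst y) (snd y)"
    using continuous_attains_inf[OF compC _ continuous_on_subset[OF c2]] by blast
  define a b r where "a = fst x" and "b = snd x" and "r = ang a b"
  have a: "norm a = 1" and b: "norm b = 1" and ab: "F a = F b" and r: "0 < r"
    using x(1) d by (auto simp: C_def a_def b_def r_def)
  have min: "a' = b'" if "norm a' = 1" "norm b' = 1" "F a' = F b'" "ang a' b' < r" for a' b'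
    using far[of a' b'] x(2)[of "(a', b')"] that by (force simp: C_def a_def b_def r_def)
  have rpi: "r \<le> pi" using ang_bounds(2)[OF a b] by (simp add: r_def)
  obtain u where u: "norm u = 1" "a \<bullet> u = 0" "b = great_arc a u r"
    using exists_great_arc[OF _ a b] by (auto simp: r_def)
  define c where "c = great_arc a u"
  have nc: "norm (c t) = 1" for t using norm_great_arc[OF a u(1,2)] by (simp add: c_def)
  have ac: "ang (c s) (c t) = \<bar>s - t\<bar>" if "\<bar>s - t\<bar> \<le> r" for s t
    using ang_great_arc[OF a u(1,2)] that rpi by (simp add: c_def)
  have c0: "c 0 = a" and cr: "c r = b" using u(3) by (auto simp: c_def great_arc_0)
  have lip: "D (F (c s)) (F (c t)) \<le> \<bar>s - t\<bar>" if "\<bar>s - t\<bar> \<le> r" for s t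
    using covering_lipschitz[OF d F nc nc, of s t] ac[OF that] by simp
  define p q m1 m2 where "p = F a" and "q = F (c (r / 2))" and "m1 = F (c (r / 4))" and "m2 = F (c (3 * r / 4))"
  have pq: "D p q = r / 2"
  proof (rule antisym)
    show "D p q \<le> r / 2" using lip[of 0 "r / 2"] r by (simp add: p_def q_def c0)
    \<comment> \<open>A shorter path from \<open>q\<close> to \<open>p\<close> would lift to one
      from \<open>c (r / 2)\<close> to a preimage of \<open>p\<close> less than \<open>r\<close>
      away from \<open>a\<close>. By minimality this preimage is \<open>a\<close>, but
      \<open>a\<close> is at angle \<open>r / 2\<close> from \<open>c (r / 2)\<close>.\<close>
    show "r / 2 \<le> D p q"
    proof (rule ccontr)
      assume less: "\<not> r / 2 \<le> D p q"
      obtain z where z: "norm z = 1" "F z = p" "ang (c (r / 2)) z \<le> D q p"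
        using covering_lift[OF d F nc, of p "r / 2"] unfolding q_def by blast
      have m: "ang a (c (r / 2)) = r / 2" using ac[of 0 "r / 2"] r by (simp add: c0)
      then have "ang a z < r"
        using ang_triangle[OF a nc[of "r / 2"] z(1)] z(3) less by (simp add: D_commute)
      then have "z = a" using min[OF a z(1)] z(2) by (simp add: p_def)
      then show False using z(3) m less by (simp add: ang_commute D_commute)
    qed
  qed
  have 1: "D p m1 \<le> r / 4" "D m1 q \<le> r / 4" "D q m2 \<le> r / 4"
    using lip[of 0 "r / 4"] lip[of "r / 4" "r / 2"] lip[of "r / 2" "3 * r / 4"] r
    by (auto simp: p_def q_def m1_def m2_def c0)
  \<comment> \<open>The loop closes here: \<open>b\<close> is the other preimage of
    \<open>p\<close>.\<close>
  have 2: "D m2 p \<le> r / 4" using lip[of "3 * r / 4" r] r by (simp add: p_def m2_def ab cr)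
  have eq: "D p m1 = r / 4" "D m1 q = r / 4" "D p m2 = r / 4" "D m2 q = r / 4"
    using 1 2 pq D_triangle[of p q m1] D_triangle[of p q m2] by (auto simp: D_commute)
  \<comment> \<open>Their preimages on the arc are at angle \<open>r / 2\<close>, too close to be
    identified.\<close>
  have "m1 \<noteq> m2"
  proof
    assume "m1 = m2"
    then have "c (r / 4) = c (3 * r / 4)"
      using min[OF nc nc, of "r / 4" "3 * r / 4"] ac[of "r / 4" "3 * r / 4"] r by (simp add: m1_def m2_def)
    then show False using ac[of "r / 4" "3 * r / 4"] r ang_self[OF nc] by simp
  qed
  moreover have "dist p q \<le> pi / 2 / sqrt k"
    unfolding dist_eq_D pq using rpi k_pos by (intro divide_right_mono) auto
  ultimately show thesis using that[of m1 m2 p q] pq eq by (simp add: dist_eq_D)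
qed

end

section \<open>Finitely supported measures\<close>

text \<open>Atoms are indexed, so points may coincide and weights may vanish, as they do at the ends
  of the range of weights used below.\<close>

definition atomic_measure :: "nat set \<Rightarrow> (nat \<Rightarrow> real) \<Rightarrow> (nat \<Rightarrow> 'a::metric_space) \<Rightarrow> 'a measure" where
  "atomic_measure I w x = distr (point_measure I (\<lambda>i. ennreal (w i))) borel x"

context
  fixes I :: "nat set" and w :: "nat \<Rightarrow> real" and x :: "nat \<Rightarrow> 'a::metric_space"
  assumes I: "finite I" and w: "\<And>i. i \<in> I \<Longrightarrow> 0 \<le> w i" and w1: "sum w I = 1"
begin

lemma measurable_atoms: "x \<in> point_measure I (\<lambda>i. ennreal (w i)) \<rightarrow>\<^sub>M borel"
  by (simp add: measurable_def space_point_measure sets_point_measure)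

lemma sets_atomic_measure: "sets (atomic_measure I w x) = sets borel"
  by (simp add: atomic_measure_def)

lemma emeasure_atomic_measure:
  assumes "B \<in> sets borel"
  shows "emeasure (atomic_measure I w x) B = (\<Sum>i\<in>{i\<in>I. x i \<in> B}. ennreal (w i))"
proof -
  have "x -` B \<inter> I = {i\<in>I. x i \<in> B}" by auto
  then show ?thesis
    unfolding atomic_measure_def using I
    by (simp add: emeasure_distr[OF measurable_atoms assms] space_point_measure emeasure_point_measure_finite)
qed

lemma prob_space_atomic_measure: "prob_space (atomic_measure I w x)"
proof (rule prob_spaceI)
  have "(\<Sum>i\<in>I. ennreal (w i)) = 1" using w w1 by (simp add: sum_ennreal)
  then show "emeasure (atomic_measure I w x) (space (atomic_measure I w x)) = 1"
    using emeasure_atomic_measure[of UNIV] by (simp add: atomic_measure_def)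
qed

lemma support_atomic_measure: "support (atomic_measure I w x) \<subseteq> x ` I"
proof
  fix y assume y: "y \<in> support (atomic_measure I w x)"
  show "y \<in> x ` I"
  proof (rule ccontr)
    assume "y \<notin> x ` I"
    moreover have op: "open (- x ` I)" using I by (simp add: open_Compl finite_imp_closed)
    ultimately have "0 < emeasure (atomic_measure I w x) (- x ` I)"
      using y by (simp add: support_def)
    moreover have "{i \<in> I. x i \<in> - x ` I} = {}" by auto
    ultimately show False using emeasure_atomic_measure[of "- x ` I"] op by (metis borel_open less_irrefl sum.empty)
  qed
qed

lemma in_support_atomic_measure:
  assumes "i \<in> I" "0 < w i"
  shows "x i \<in> support (atomic_measure I w x)"
  unfolding support_def
proof (intro CollectI allI impI)
  fix U assume U: "open U" "x i \<in> U"
  have "0 < ennreal (w i)" using assms by simp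
  also have "\<dots> \<le> (\<Sum>i\<in>{i\<in>I. x i \<in> U}. ennreal (w i))"
    using I assms U by (intro member_le_sum) auto
  finally show "0 < emeasure (atomic_measure I w x) U" using emeasure_atomic_measure U by simp
qed

lemma mean_objective_atomic_measure:
  assumes "\<gamma> \<noteq> \<infinity>"
  shows "mean_objective \<gamma> (atomic_measure I w x) m
    = ennreal (\<Sum>i\<in>I. w i * dist (x i) m powr enn2real \<gamma>)"
proof -
  have "(\<lambda>y. dist y m) \<in> borel_measurable borel"
    by (intro borel_measurable_continuous_onI continuous_intros)
  then have "(\<lambda>y. ennreal (dist y m powr enn2real \<gamma>)) \<in> borel_measurable borel" by measurable
  then have "mean_objective \<gamma> (atomic_measure I w x) m
      = (\<Sum>i\<in>I. ennreal (w i) * ennreal (dist (x i) m powr enn2real \<gamma>))"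
    using assms I unfolding mean_objective_def atomic_measure_def
    by (simp add: nn_integral_distr[OF measurable_atoms] nn_integral_point_measure_finite)
  also have "\<dots> = ennreal (\<Sum>i\<in>I. w i * dist (x i) m powr enn2real \<gamma>)"
    using w by (simp add: sum_ennreal flip: ennreal_mult')
  finally show ?thesis .
qed

lemma mean_objective_infinity_atomic_measure_le:
  assumes c: "\<And>i. i \<in> I \<Longrightarrow> dist (x i) m \<le> c"
  shows "mean_objective \<infinity> (atomic_measure I w x) m \<le> ennreal c"
proof -
  let ?P = "atomic_measure I w x" and ?f = "\<lambda>y. ennreal (dist y m)"
  have "(\<lambda>y. dist y m) \<in> borel_measurable borel"
    by (intro borel_measurable_continuous_onI continuous_intros)
  then have meas: "?f \<in> borel_measurable ?P"
    by (simp add: atomic_measure_def)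
  have op: "open {y. ennreal c < ?f y}"
    by (intro open_Collect_less continuous_on_ennreal continuous_intros)
  have "{i \<in> I. x i \<in> {y. ennreal c < ?f y}} = {}" using c by (auto simp: not_less intro!: ennreal_leI)
  then have "emeasure ?P {y. ennreal c < ?f y} = 0"
    using emeasure_atomic_measure[OF borel_open[OF op]] by (metis sum.empty)
  then have "AE y in ?P. ?f y \<le> ennreal c"
    using op by (intro AE_I[of _ _ "{y. ennreal c < ?f y}"]) (auto simp: sets_atomic_measure)
  then show ?thesis using meas by (simp add: mean_objective_def esssup_I)
qed

text \<open>Where the distance exceeds the essential supremum is a null set, and it is open; a point
  of the support cannot lie in it.\<close>

lemma mean_objective_infinity_atomic_measure_ge:
  assumes i: "i \<in> I" "0 < w i"
  shows "ennreal (dist (x i) m) \<le> mean_objective \<infinity> (atomic_measure I w x) m"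
proof (rule ccontr)
  let ?P = "atomic_measure I w x" and ?f = "\<lambda>y. ennreal (dist y m)"
  define e where "e = esssup ?P ?f"
  assume "\<not> ennreal (dist (x i) m) \<le> mean_objective \<infinity> ?P m"
  then have "x i \<in> {y. e < ?f y}" by (simp add: mean_objective_def e_def)
  moreover have "open {y. e < ?f y}"
    by (intro open_Collect_less continuous_on_ennreal continuous_intros)
  ultimately have "0 < emeasure ?P {y. e < ?f y}"
    using in_support_atomic_measure[OF i] by (simp add: support_def)
  moreover have "emeasure ?P {y \<in> space ?P. e < ?f y} = 0"
    unfolding e_def by (rule esssup_zero_measure)
  ultimately show False by (simp add: atomic_measure_def)
qed

end

section \<open>Pairs of points with two midpoints\<close>

lemma powr_midpoint_convex:
  fixes a b g :: real
  assumes "0 \<le> a" "0 \<le> b" "1 \<le> g"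
  shows "((a + b) / 2) powr g \<le> (a powr g + b powr g) / 2"
proof (cases "a = 0 \<or> b = 0")
  case True
  have "(c / 2) powr g \<le> c powr g / 2" if "0 \<le> c" for c :: real
  proof -
    have "(2::real) powr 1 \<le> 2 powr g" using assms by (intro powr_mono) auto
    then have "c powr g / 2 powr g \<le> c powr g / 2" by (intro divide_left_mono) auto
    then show ?thesis using that by (simp add: powr_divide)
  qed
  then show ?thesis using True assms by auto
next
  case False
  then have "((1 - 1/2) *\<^sub>R a + (1/2) *\<^sub>R b) powr g \<le> (1 - 1/2) * (a powr g) + (1/2) * (b powr g)"
    using assms by (intro convex_onD[OF powr_convex]) auto
  then show ?thesis by (simp add: field_simps)
qed

text \<open>With equal masses every midpoint minimises: by the triangle inequality alone for the
  maximum of the two distances, and together with convexity of the power for finite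
  exponents.\<close>

lemma two_midpoints_not_unique_mean:
  fixes p q m1 m2 :: "'a::metric_space"
  assumes g: "1 \<le> \<gamma>" and ne: "m1 \<noteq> m2"
    and m1: "dist p m1 = dist p q / 2" "dist m1 q = dist p q / 2"
    and m2: "dist p m2 = dist p q / 2" "dist m2 q = dist p q / 2"
  shows "{p, q} \<notin> unique_mean_sets \<gamma>"
proof
  assume A: "{p, q} \<in> unique_mean_sets \<gamma>"
  define I :: "nat set" where "I = {0, 1}"
  define w :: "nat \<Rightarrow> real" where "w i = 1 / 2" for i
  define x where "x i = (if i = 0 then p else q)" for i :: nat
  define P where "P = atomic_measure I w x"
  have wpos: "0 < w i" for i by (simp add: w_def)
  have I: "finite I" "\<And>i. i \<in> I \<Longrightarrow> 0 \<le> w i" "sum w I = 1" by (auto simp: I_def w_def)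
  have min: "is_intrinsic_mean \<gamma> P m"
    if m: "dist p m = dist p q / 2" "dist m q = dist p q / 2" for m
  proof -
    have "mean_objective \<gamma> P m \<le> mean_objective \<gamma> P y" for y
    proof (cases "\<gamma> = \<infinity>")
      case True
      have "dist (x i) m \<le> dist p q / 2" for i
        using m by (auto simp: x_def dist_commute)
      then have 1: "mean_objective \<gamma> P m \<le> ennreal (dist p q / 2)"
        unfolding True P_def by (intro mean_objective_infinity_atomic_measure_le[OF I])
      have ge: "ennreal (dist (x i) y) \<le> mean_objective \<gamma> P y" if "i \<in> I" for i
        unfolding True P_def by (rule mean_objective_infinity_atomic_measure_ge[OF I that wpos])
      then have 2: "ennreal (dist p y) \<le> mean_objective \<gamma> P y" "ennreal (dist q y) \<le> mean_objective \<gamma> P y"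
        using ge[of 0] ge[of 1] by (simp_all add: x_def I_def)
      have "dist p q / 2 \<le> max (dist p y) (dist q y)"
        using dist_triangle[of p q y] by (simp add: dist_commute max_def)
      then have "ennreal (dist p q / 2) \<le> ennreal (max (dist p y) (dist q y))" by (rule ennreal_leI)
      also have "\<dots> \<le> mean_objective \<gamma> P y" using 2 by (simp add: max_def)
      finally show ?thesis using 1 by simp
    next
      case False
      define g where "g = enn2real \<gamma>"
      have "\<gamma> = ennreal g" unfolding g_def using False by (simp add: less_top)
      then have g1: "1 \<le> g" using \<open>1 \<le> \<gamma>\<close> by simp
      have obj: "mean_objective \<gamma> P z = ennreal ((dist p z powr g + dist q z powr g) / 2)" for z
        unfolding P_def using mean_objective_atomic_measure[OF I False, of x z]
        by (simp add: I_def w_def x_def g_def field_simps)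
      have "(dist p m powr g + dist q m powr g) / 2 = (dist p q / 2) powr g"
        unfolding dist_commute[of q m] m by simp
      also have "\<dots> \<le> ((dist p y + dist q y) / 2) powr g"
        using dist_triangle[of p q y] g1 by (intro powr_mono2) (auto simp: dist_commute)
      also have "\<dots> \<le> (dist p y powr g + dist q y powr g) / 2"
        using g1 by (intro powr_midpoint_convex) auto
      finally show ?thesis unfolding obj by (rule ennreal_leI)
    qed
    then show ?thesis by (auto simp: is_intrinsic_mean_def is_arg_min_linorder)
  qed
  have "x 0 \<in> support P"
    unfolding P_def by (rule in_support_atomic_measure[OF I]) (auto simp: I_def w_def)
  moreover have "support P \<subseteq> {p, q}"
    using support_atomic_measure[OF I, of x] by (auto simp: P_def I_def x_def split: if_splits)
  ultimately have "\<exists>!m. is_intrinsic_mean \<gamma> P m"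
    using A prob_space_atomic_measure[OF I, of x] sets_atomic_measure[OF I, of x]
    by (auto simp: unique_mean_sets_def P_def)
  then show False using min[OF m1] min[OF m2] ne by blast
qed

lemma D_L_le_ediameter:
  fixes A :: "'a::metric_space set"
  assumes "A \<notin> unique_mean_sets \<gamma>"
  shows "D_L TYPE('a) \<gamma> \<le> ediameter A"
  unfolding D_L_def using assms by (intro Sup_least) (auto simp: not_less[symmetric])

lemma ediameter_le:
  assumes "\<And>x y. x \<in> A \<Longrightarrow> y \<in> A \<Longrightarrow> dist x y \<le> c"
  shows "ediameter A \<le> ennreal c"
  unfolding ediameter_def using assms by (intro SUP_least ennreal_leI) auto

section \<open>Three points on the sphere\<close>

lemma inner_vector_3: "(v :: real ^ 3) \<bullet> w = v $ 1 * w $ 1 + v $ 2 * w $ 2 + v $ 3 * w $ 3"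
  by (simp add: inner_vec_def sum_3)

lemma norm_eq_1_vector_3: "norm (v :: real ^ 3) = 1 \<longleftrightarrow> (v $ 1)\<^sup>2 + (v $ 2)\<^sup>2 + (v $ 3)\<^sup>2 = 1"
  by (simp add: norm_eq_1 inner_vector_3 power2_eq_square)

text \<open>The configuration consists of the south pole \<open>s\<close> and the points
  \<open>p 1\<close> and \<open>p (-1)\<close> at latitude \<theta>. These are mirror images in the
  plane where the second coordinate vanishes, and \<open>c\<close> is the cosine of half their
  longitude difference.\<close>

locale three_points =
  fixes g \<theta> c :: real
  assumes g: "1 \<le> g" and \<theta>: "0 \<le> \<theta>" "\<theta> < pi / 2" and c: "0 \<le> c" "c < 1"
begin

definition s :: "real ^ 3" where "s = vector [0, 0, -1]"

definition p :: "real \<Rightarrow> real ^ 3" where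
  "p \<sigma> = vector [cos \<theta> * c, \<sigma> * (cos \<theta> * sqrt (1 - c\<^sup>2)), sin \<theta>]"

definition f :: "real \<Rightarrow> real ^ 3 \<Rightarrow> real" where
  "f w m = w * ang s m powr g + (1 - w) / 2 * (ang (p 1) m powr g + ang (p (-1)) m powr g)"

definition minimiser :: "real \<Rightarrow> real ^ 3 \<Rightarrow> bool" where
  "minimiser w m \<longleftrightarrow> m \<in> sphere 0 1 \<and> (\<forall>m'\<in>sphere 0 1. f w m \<le> f w m')"

text \<open>The angle from \<open>p 1\<close> or \<open>p (-1)\<close> to the point of latitude
  \<theta> on the meridian halfway between them.\<close>

definition a :: real where "a = arccos ((sin \<theta>)\<^sup>2 + (cos \<theta>)\<^sup>2 * c)"

definition b :: real where "b = ang (p 1) (p (-1))"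

lemma c2: "0 \<le> 1 - c\<^sup>2" "0 < 1 - c\<^sup>2"
  using c power_less_one_iff[of c 2] by (auto simp: power_le_one)

lemma cos_pos: "0 < cos \<theta>" and sin_nonneg: "0 \<le> sin \<theta>"
  using \<theta> by (auto intro: cos_gt_zero_pi sin_ge_zero)

lemma norm_s: "norm s = 1"
  by (simp add: norm_eq_1_vector_3 s_def)

lemma norm_p: "\<sigma>\<^sup>2 = 1 \<Longrightarrow> norm (p \<sigma>) = 1"
  using c2 by (simp add: norm_eq_1_vector_3 p_def power_mult_distrib algebra_simps sin_squared_eq)

lemma norm_p1: "norm (p 1) = 1" "norm (p (-1)) = 1"
  by (auto intro: norm_p)

lemma inner_s: "s \<bullet> m = - (m $ 3)"
  by (simp add: inner_vector_3 s_def)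

lemma inner_p: "p \<sigma> \<bullet> m = cos \<theta> * c * m $ 1 + \<sigma> * (cos \<theta> * sqrt (1 - c\<^sup>2)) * m $ 2 + sin \<theta> * m $ 3"
  by (simp add: inner_vector_3 p_def)

lemma cos_b: "cos b = (cos \<theta>)\<^sup>2 * (2 * c\<^sup>2 - 1) + (sin \<theta>)\<^sup>2"
proof -
  have "cos b = p 1 \<bullet> p (-1)" unfolding b_def by (rule cos_ang[OF norm_p1])
  also have "\<dots> = (cos \<theta>)\<^sup>2 * c\<^sup>2 - (cos \<theta>)\<^sup>2 * (sqrt (1 - c\<^sup>2))\<^sup>2 + (sin \<theta>)\<^sup>2"
    unfolding inner_p by (simp add: p_def power2_eq_square)
  also have "\<dots> = (cos \<theta>)\<^sup>2 * (2 * c\<^sup>2 - 1) + (sin \<theta>)\<^sup>2"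
    using c2 by (simp add: algebra_simps)
  finally show ?thesis .
qed

lemma ang_s_p: "\<sigma>\<^sup>2 = 1 \<Longrightarrow> ang s (p \<sigma>) = pi / 2 + \<theta>"
  using \<theta> by (intro ang_eqI) (auto simp: inner_s p_def cos_add)

lemma continuous_on_f:
  assumes "continuous_on X u" "continuous_on X v" "\<And>x. x \<in> X \<Longrightarrow> norm (v x) = 1"
  shows "continuous_on X (\<lambda>x. f (u x) (v x))"
  unfolding f_def using assms g norm_s norm_p1 ang_bounds(1)
  by (intro continuous_intros continuous_on_powr') auto

lemma exists_minimiser: "\<exists>m. minimiser w m"
proof -
  have "continuous_on (sphere 0 1) (f w)" using continuous_on_f[of "sphere 0 1" "\<lambda>_. w" "\<lambda>x. x"] by simp
  then obtain m where "m \<in> sphere 0 1" "\<And>m'. m' \<in> sphere 0 1 \<Longrightarrow> f w m \<le> f w m'"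
    using continuous_attains_inf[of "sphere 0 1" "f w"] norm_s by auto
  then show ?thesis by (auto simp: minimiser_def)
qed

text \<open>Stands in for continuity of the minimiser in the weight. The pairs of a weight and a
  minimiser in \<open>K\<close> form a compact set, cut out by one closed condition for each
  competitor, and the weights are its projection.\<close>

lemma closed_minimiser_weights:
  assumes K: "closed K"
  shows "closed {w \<in> {0..1}. \<exists>m\<in>K. minimiser w m}"
proof -
  define Q where "Q = {0..1::real} \<times> (sphere 0 1 \<inter> K)"
  have Q: "compact Q" unfolding Q_def using K by (intro compact_Times compact_Int_closed) auto
  define R where "R m' = {x \<in> Q. f (fst x) (snd x) \<le> f (fst x) m'}" for m'
  have R: "closed (R m')" if "norm m' = 1" for m'
  proof -
    have "continuous_on Q (\<lambda>x. f (fst x) (snd x) - f (fst x) m')"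
      using that by (intro continuous_intros continuous_on_f) (auto simp: Q_def)
    then have "closed (Q \<inter> (\<lambda>x. f (fst x) (snd x) - f (fst x) m') -` {..0})"
      using Q by (intro continuous_closed_preimage) (auto simp: compact_imp_closed)
    also have "Q \<inter> (\<lambda>x. f (fst x) (snd x) - f (fst x) m') -` {..0} = R m'" by (auto simp: R_def)
    finally show ?thesis .
  qed
  have "compact (Q \<inter> (\<Inter>m'\<in>sphere 0 1. R m'))"
    using Q R by (intro compact_Int_closed closed_INT) auto
  then have "compact (fst ` (Q \<inter> (\<Inter>m'\<in>sphere 0 1. R m')))"
    by (intro compact_continuous_image continuous_intros)
  also have "fst ` (Q \<inter> (\<Inter>m'\<in>sphere 0 1. R m')) = {w \<in> {0..1}. \<exists>m\<in>K. minimiser w m}"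
  proof (intro equalityI subsetI)
    fix w assume "w \<in> fst ` (Q \<inter> (\<Inter>m'\<in>sphere 0 1. R m'))"
    then show "w \<in> {w \<in> {0..1}. \<exists>m\<in>K. minimiser w m}"
      by (force simp: Q_def R_def minimiser_def)
  next
    fix w assume "w \<in> {w \<in> {0..1}. \<exists>m\<in>K. minimiser w m}"
    then obtain m where "w \<in> {0..1}" "m \<in> K" "minimiser w m" by blast
    then have "(w, m) \<in> Q \<inter> (\<Inter>m'\<in>sphere 0 1. R m')" by (auto simp: Q_def R_def minimiser_def)
    then show "w \<in> fst ` (Q \<inter> (\<Inter>m'\<in>sphere 0 1. R m'))" by force
  qed
  finally show ?thesis by (rule compact_imp_closed)
qed

text \<open>Without mass at \<open>s\<close> the midpoint of \<open>p 1\<close> and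
  \<open>p (-1)\<close> minimises, by the triangle inequality and convexity. It arises from the
  midpoint of the chord, of height sin \<theta>, by scaling up to length 1, so it lies no
  lower.\<close>

lemma minimiser_0:
  assumes b: "b \<le> pi / 2 + \<theta>"
  shows "\<exists>m. minimiser 0 m \<and> sin \<theta> \<le> m $ 3"
proof -
  \<comment> \<open>The norm of the midpoint of the chord, equal to cos (b / 2); it is positive
    because \<open>b\<close> is below pi.\<close>
  define N where "N = sqrt ((cos \<theta>)\<^sup>2 * c\<^sup>2 + (sin \<theta>)\<^sup>2)"
  have N2: "N\<^sup>2 = (cos \<theta>)\<^sup>2 * c\<^sup>2 + (sin \<theta>)\<^sup>2" unfolding N_def by simp
  have b0: "0 \<le> b" "b \<le> pi" unfolding b_def using ang_bounds[OF norm_p1] by auto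
  have "b < pi" using b \<theta> by simp
  then have cb: "0 < cos (b / 2)" using b0 by (intro cos_gt_zero_pi) auto
  have "cos b = 2 * N\<^sup>2 - 1" unfolding cos_b N2 by (simp add: algebra_simps sin_squared_eq)
  then have "(cos (b / 2))\<^sup>2 = N\<^sup>2" using cos_double_cos[of "b / 2"] by simp
  then have N: "N = cos (b / 2)" 
  proof -
    have "0 \<le> N" unfolding N_def by simp
    then show ?thesis using power2_eq_imp_eq[of "cos (b / 2)" N] cb \<open>(cos (b / 2))\<^sup>2 = N\<^sup>2\<close> by linarith
  qed
  define M :: "real ^ 3" where "M = vector [cos \<theta> * c / N, 0, sin \<theta> / N]"
  have Npos: "0 < N" using N cb by simp
  have nM: "norm M = 1"
    using Npos by (simp add: norm_eq_1_vector_3 M_def power_divide power_mult_distrib flip: add_divide_distrib N2)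
  have pM: "ang (p \<sigma>) M = b / 2" for \<sigma>
  proof (rule ang_eqI)
    have "p \<sigma> \<bullet> M = N\<^sup>2 / N" unfolding N2 using Npos
      by (simp add: inner_p M_def power2_eq_square add_divide_distrib)
    then show "p \<sigma> \<bullet> M = cos (b / 2)" using Npos N by (simp add: power2_eq_square)
  qed (use b0 in auto)
  have "minimiser 0 M"
    unfolding minimiser_def
  proof (intro conjI ballI)
    fix m :: "real ^ 3" assume m: "m \<in> sphere 0 1"
    then have nm: "norm m = 1" by simp
    have pos: "0 \<le> ang (p 1) m" "0 \<le> ang (p (-1)) m" using ang_bounds(1) norm_p1 nm by auto
    have "f 0 M = (b / 2) powr g" by (simp add: f_def pM)
    also have "\<dots> \<le> ((ang (p 1) m + ang (p (-1)) m) / 2) powr g"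
      using ang_triangle[OF norm_p1(1) nm norm_p1(2)] b0 g
      by (intro powr_mono2) (auto simp: b_def ang_commute)
    also have "\<dots> \<le> (ang (p 1) m powr g + ang (p (-1)) m powr g) / 2"
      using g pos by (intro powr_midpoint_convex) auto
    also have "\<dots> = f 0 m" by (simp add: f_def)
    finally show "f 0 M \<le> f 0 m" .
  qed (use nM in simp)
  moreover have "sin \<theta> \<le> M $ 3"
  proof -
    have "N \<le> 1" using N by simp
    then have "sin \<theta> * N \<le> sin \<theta> * 1" using sin_nonneg by (intro mult_left_mono)
    then show ?thesis using Npos by (simp add: M_def le_divide_eq)
  qed
  ultimately show ?thesis by blast
qed

lemma minimiser_1: "minimiser 1 s"
  using ang_self[OF norm_s] norm_s by (simp add: minimiser_def f_def)

text \<open>As the weight of \<open>s\<close> grows from 0 to 1, a minimiser must pass the height \<open>sin \<theta>\<close>.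
  There, all distances from \<open>s\<close> agree, and \<open>p 1\<close> does at least as well as a point on the
  plane of symmetry.\<close>

lemma two_minimisers:
  assumes b: "b \<le> pi / 2 + \<theta>" and ba: "b powr g = 2 * a powr g"
  shows "\<exists>w\<in>{0..1}. \<exists>m m'. m \<noteq> m' \<and> minimiser w m \<and> minimiser w m'"
proof -
  define U where "U = {w \<in> {0..1}. \<exists>m\<in>{m. sin \<theta> \<le> m $ 3}. minimiser w m}"
  define L where "L = {w \<in> {0..1}. \<exists>m\<in>{m. m $ 3 \<le> sin \<theta>}. minimiser w m}"
  have "closed U" "closed L" unfolding U_def L_def
    by (intro closed_minimiser_weights closed_Collect_le continuous_intros)+
  moreover have "{0..1} \<subseteq> U \<union> L"
  proof
    fix w :: real assume w: "w \<in> {0..1}"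
    obtain m where "minimiser w m" using exists_minimiser by blast
    then show "w \<in> U \<union> L" using w linear[of "sin \<theta>" "m $ 3"] by (auto simp: U_def L_def)
  qed
  moreover have "0 \<in> U \<inter> {0..1}" using minimiser_0[OF b] by (auto simp: U_def)
  moreover have "1 \<in> L \<inter> {0..1}" 
  proof -
    have "s $ 3 \<le> sin \<theta>" by (simp add: s_def)
    then show ?thesis using minimiser_1 by (auto simp: L_def)
  qed
  \<comment> \<open>At a common weight there is a minimiser on or above the height and one on or
    below it. Either they differ, or a single one has exactly height sin \<theta>.\<close>
  ultimately have "U \<inter> L \<inter> {0..1} \<noteq> {}"
    using connected_closedD[OF connected_Icc[of 0 1], of U L] by blast
  then obtain w where w: "w \<in> {0..1}" "w \<in> U" "w \<in> L" by blast
  obtain m m' where m: "minimiser w m" "sin \<theta> \<le> m $ 3" and m': "minimiser w m'" "m' $ 3 \<le> sin \<theta>"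
    using w by (auto simp: U_def L_def)
  show ?thesis
  proof (cases "m = m'")
    case False
    then show ?thesis using w(1) m(1) m'(1) by blast
  next
    case True
    then have m3: "m $ 3 = sin \<theta>" using m m' by simp
    have nm: "norm m = 1" using m(1) by (simp add: minimiser_def)
    \<comment> \<open>The mirror image in the plane of symmetry: a second minimiser unless
      \<open>m\<close> lies on that plane.\<close>
    define r :: "real ^ 3" where "r = vector [m $ 1, - (m $ 2), m $ 3]"
    have nr: "norm r = 1" using nm by (simp add: norm_eq_1_vector_3 r_def)
    have "ang s r = ang s m" "ang (p \<sigma>) r = ang (p (- \<sigma>)) m" for \<sigma>
      by (simp_all add: ang_def inner_s inner_p r_def)
    then have "f w r = f w m" by (simp add: f_def)
    then have r: "minimiser w r" using m(1) nr by (simp add: minimiser_def)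
    \<comment> \<open>On the plane this height leaves the first coordinates plus or minus cos
      \<theta>. In both cases the angles to \<open>p 1\<close> and \<open>p (-1)\<close> are at
      least \<open>a\<close>, as \<open>c\<close> is nonnegative.\<close>
    have m1: "m $ 1 \<le> cos \<theta>" if "m $ 2 = 0"
    proof -
      have "(m $ 1)\<^sup>2 = (cos \<theta>)\<^sup>2"
        using nm that m3 by (simp add: norm_eq_1_vector_3 cos_squared_eq)
      then show ?thesis using cos_pos by (auto simp: power2_eq_iff)
    qed
    have p1: "minimiser w (p 1)" if m2: "m $ 2 = 0"
    proof -
      have "cos \<theta> * c * m $ 1 \<le> cos \<theta> * c * cos \<theta>"
        using m1[OF m2] c cos_pos by (intro mult_left_mono) auto
      then have "p \<sigma> \<bullet> m \<le> (sin \<theta>)\<^sup>2 + (cos \<theta>)\<^sup>2 * c" for \<sigma>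
        using m2 m3 by (simp add: inner_p power2_eq_square algebra_simps)
      moreover have "(sin \<theta>)\<^sup>2 + (cos \<theta>)\<^sup>2 * c \<le> (sin \<theta>)\<^sup>2 + (cos \<theta>)\<^sup>2 * 1"
        using c by (intro add_left_mono mult_left_mono) auto
      ultimately have "a \<le> ang (p \<sigma>) m" if "\<sigma>\<^sup>2 = 1" for \<sigma>
        unfolding a_def ang_def using inner_unit_bounds[OF norm_p[OF that] nm]
        by (intro arccos_le_arccos) auto
      moreover have "0 \<le> (sin \<theta>)\<^sup>2 + (cos \<theta>)\<^sup>2 * c" using c by simp
      then have "0 \<le> a"
        unfolding a_def
        using \<open>(sin \<theta>)\<^sup>2 + (cos \<theta>)\<^sup>2 * c \<le> (sin \<theta>)\<^sup>2 + (cos \<theta>)\<^sup>2 * 1\<close>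
        by (intro arccos_lbound) simp_all
      ultimately have "a powr g \<le> ang (p \<sigma>) m powr g" if "\<sigma>\<^sup>2 = 1" for \<sigma>
        using g that by (intro powr_mono2) auto
      then have "a powr g \<le> ang (p 1) m powr g" "a powr g \<le> ang (p (-1)) m powr g" by auto
      then have "b powr g \<le> ang (p 1) m powr g + ang (p (-1)) m powr g" using ba by linarith
      moreover have "ang s m = ang s (p 1)" by (simp add: ang_def inner_s m3 p_def)
      moreover have "ang (p (-1)) (p 1) = b" by (simp add: b_def ang_commute)
      ultimately have "f w (p 1) \<le> f w m"
        using w(1) ang_self[OF norm_p1(1)] unfolding f_def
        by (intro add_mono[OF _ mult_left_mono]) auto
      then show ?thesis using m(1) norm_p1 unfolding minimiser_def by force
    qed
    have "p 1 \<noteq> m" if "m $ 2 = 0"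
    proof
      assume "p 1 = m"
      then have "cos \<theta> * sqrt (1 - c\<^sup>2) = 0" using that by (auto simp: p_def)
      then show False using cos_pos c2 by auto
    qed
    moreover have "r \<noteq> m" if "m $ 2 \<noteq> 0"
    proof
      assume "r = m"
      then have "r $ 2 = m $ 2" by simp
      then show False using that by (simp add: r_def)
    qed
    ultimately show ?thesis using w(1) m(1) r p1 by (cases "m $ 2 = 0") blast+
  qed
qed

lemma not_unique_mean:
  fixes F :: "real ^ 3 \<Rightarrow> 'a::metric_space"
  assumes surj: "F ` sphere 0 1 = UNIV" and K: "0 < K"
    and iso: "\<And>u v. norm u = 1 \<Longrightarrow> norm v = 1 \<Longrightarrow> dist (F u) (F v) = ang u v / K"
    and b: "b \<le> pi / 2 + \<theta>" and ba: "b powr g = 2 * a powr g"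
  shows "{F s, F (p 1), F (p (-1))} \<notin> unique_mean_sets (ennreal g)"
    and "ediameter {F s, F (p 1), F (p (-1))} \<le> ennreal ((pi / 2 + \<theta>) / K)"
proof -
  obtain w m m' where w: "w \<in> {0..1}" and m: "m \<noteq> m'" "minimiser w m" "minimiser w m'"
    using two_minimisers[OF b ba] by blast
  define I :: "nat set" where "I = {0, 1, 2}"
  define \<omega> where "\<omega> i = (if i = 0 then w else (1 - w) / 2)" for i :: nat
  define x where "x i = F (if i = 0 then s else if i = 1 then p 1 else p (-1))" for i :: nat
  define P where "P = atomic_measure I \<omega> x"
  have I: "finite I" "\<And>i. i \<in> I \<Longrightarrow> 0 \<le> \<omega> i" "sum \<omega> I = 1" using w by (auto simp: I_def \<omega>_def)
  have obj: "mean_objective (ennreal g) P (F y) = ennreal (f w y / K powr g)" if "norm y = 1" for y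
  proof -
    have "mean_objective (ennreal g) P (F y) = ennreal (\<Sum>i\<in>I. \<omega> i * dist (x i) (F y) powr g)"
      unfolding P_def using mean_objective_atomic_measure[OF I, of "ennreal g" x] g by simp
    also have "(\<Sum>i\<in>I. \<omega> i * dist (x i) (F y) powr g) = f w y / K powr g"
      using that norm_s norm_p1 K ang_bounds(1)
      by (simp add: I_def \<omega>_def x_def iso f_def powr_divide field_simps)
    finally show ?thesis .
  qed
  have mean: "is_intrinsic_mean (ennreal g) P (F y)" if y: "minimiser w y" for y
  proof -
    have "mean_objective (ennreal g) P (F y) \<le> mean_objective (ennreal g) P z" for z
    proof -
      obtain v where v: "z = F v" "norm v = 1" using surj by (metis UNIV_I imageE mem_sphere_0)
      have "f w y / K powr g \<le> f w v / K powr g"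
        using y v K by (intro divide_right_mono) (auto simp: minimiser_def)
      then show ?thesis using obj v y by (auto simp: minimiser_def intro: ennreal_leI)
    qed
    then show ?thesis by (auto simp: is_intrinsic_mean_def is_arg_min_linorder)
  qed
  have "F m \<noteq> F m'"
  proof
    assume "F m = F m'"
    then have "ang m m' = 0" using iso[of m m'] m K by (simp add: minimiser_def)
    then show False using m ang_eq_0_iff[of m m'] by (simp add: minimiser_def)
  qed
  then have no: "\<not> (\<exists>!m. is_intrinsic_mean (ennreal g) P m)" using mean m by blast
  \<comment> \<open>For \<open>w = 0\<close> the pole carries no mass; then the other two atoms
    do.\<close>
  have "\<exists>i\<in>I. 0 < \<omega> i" using w by (cases "w = 0") (auto simp: I_def \<omega>_def)
  then have "support P \<noteq> {}"
    unfolding P_def using in_support_atomic_measure[OF I, of _ x] by blast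
  moreover have "support P \<subseteq> {F s, F (p 1), F (p (-1))}"
    using support_atomic_measure[OF I, of x] by (auto simp: P_def I_def x_def split: if_splits)
  ultimately show "{F s, F (p 1), F (p (-1))} \<notin> unique_mean_sets (ennreal g)"
    using no prob_space_atomic_measure[OF I, of x] sets_atomic_measure[OF I, of x]
    by (auto simp: unique_mean_sets_def P_def)
  have le: "ang u v \<le> pi / 2 + \<theta>" if "u \<in> {s, p 1, p (-1)}" "v \<in> {s, p 1, p (-1)}" for u v
    using that b \<theta> ang_s_p[of 1] ang_s_p[of "-1"] ang_self[OF norm_s] ang_self[OF norm_p1(1)]
      ang_self[OF norm_p1(2)] by (auto simp: b_def ang_commute)
  then show "ediameter {F s, F (p 1), F (p (-1))} \<le> ennreal ((pi / 2 + \<theta>) / K)"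
  proof (intro ediameter_le)
    fix x y assume "x \<in> {F s, F (p 1), F (p (-1))}" "y \<in> {F s, F (p 1), F (p (-1))}"
    then obtain u v where uv: "u \<in> {s, p 1, p (-1)}" "v \<in> {s, p 1, p (-1)}" "x = F u" "y = F v"
      by blast
    then have "dist x y = ang u v / K" using iso[of u v] norm_s norm_p1 by auto
    also have "\<dots> \<le> (pi / 2 + \<theta>) / K"
      using K le[OF uv(1,2)] by (intro divide_right_mono) auto
    finally show "dist x y \<le> (pi / 2 + \<theta>) / K" .
  qed
qed

end

section \<open>The critical angle\<close>

text \<open>Cosine of half the longitude difference of the two points at latitude \<open>\<theta>\<close>: as far apart
  as the diameter allows up to \<open>pi / 6\<close>, opposite to each other beyond.\<close>

definition half_longitude_cos :: "real \<Rightarrow> real" where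
  "half_longitude_cos \<theta> = (if \<theta> \<le> pi / 6 then sqrt (1 - 1 / (2 * (1 - sin \<theta>))) else 0)"

text \<open>This is the angle \<open>b\<close> of the configuration, as
  \<open>three_points_side_leg\<close> shows. Beyond pi / 6 it is the arc over the north pole; both
  branches give 2 pi / 3 at pi / 6.\<close>

definition side :: "real \<Rightarrow> real" where
  "side \<theta> = (if \<theta> \<le> pi / 6 then pi / 2 + \<theta> else pi - 2 * \<theta>)"

definition leg :: "real \<Rightarrow> real" where
  "leg \<theta> = arccos ((sin \<theta>)\<^sup>2 + (cos \<theta>)\<^sup>2 * half_longitude_cos \<theta>)"

lemma sin_le_half:
  assumes "0 \<le> \<theta>" "\<theta> \<le> pi / 6"
  shows "sin \<theta> \<le> 1 / 2"
  using sin_monotone_2pi_le[of \<theta> "pi / 6"] assms by (simp add: sin_30)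

lemma half_longitude_cos_bounds:
  assumes "0 \<le> \<theta>"
  shows "0 \<le> half_longitude_cos \<theta>" "half_longitude_cos \<theta> < 1"
proof -
  have "0 \<le> 1 - 1 / (2 * (1 - sin \<theta>)) \<and> 1 - 1 / (2 * (1 - sin \<theta>)) < 1" if "\<theta> \<le> pi / 6"
    using sin_le_half[OF assms that] by (simp add: field_simps)
  then show "0 \<le> half_longitude_cos \<theta>" "half_longitude_cos \<theta> < 1"
    by (auto simp: half_longitude_cos_def)
qed

lemma leg_pos:
  assumes "0 \<le> \<theta>" "\<theta> < pi / 2"
  shows "0 < leg \<theta>"
proof -
  have "0 < (cos \<theta>)\<^sup>2" using cos_gt_zero_pi[of \<theta>] assms by simp
  then have "(cos \<theta>)\<^sup>2 * half_longitude_cos \<theta> < (cos \<theta>)\<^sup>2 * 1"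
    using half_longitude_cos_bounds[OF assms(1)] by (intro mult_strict_left_mono)
  then have "(sin \<theta>)\<^sup>2 + (cos \<theta>)\<^sup>2 * half_longitude_cos \<theta> < 1"
    using sin_cos_squared_add[of \<theta>] by linarith
  moreover have "0 \<le> (sin \<theta>)\<^sup>2 + (cos \<theta>)\<^sup>2 * half_longitude_cos \<theta>"
    using half_longitude_cos_bounds[OF assms(1)] by simp
  ultimately show ?thesis unfolding leg_def
    using arccos_less_arccos[of "(sin \<theta>)\<^sup>2 + (cos \<theta>)\<^sup>2 * half_longitude_cos \<theta>" 1] by simp
qed

lemma gamma0_eq:
  assumes "\<theta> < pi / 2"
  shows "gamma0 \<theta> = inverse (log 2 (side \<theta> / leg \<theta>))"
  using assms by (simp add: gamma0_def side_def leg_def half_longitude_cos_def field_simps)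

lemma continuous_on_leg: "continuous_on {0..<pi / 2} leg"
proof -
  have h: "continuous_on {0..<pi / 2} half_longitude_cos"
    unfolding half_longitude_cos_def
  proof (rule continuous_on_cases_le)
    have "sin t \<noteq> 1" if "0 \<le> t" "t \<le> pi / 6" for t using sin_le_half[OF that] by simp
    then show "continuous_on {t \<in> {0..<pi / 2}. t \<le> pi / 6} (\<lambda>t. sqrt (1 - 1 / (2 * (1 - sin t))))"
      by (intro continuous_intros) auto
  next
    fix t :: real assume "t = pi / 6"
    then have "sin t = 1 / 2" by (simp only: sin_30)
    then show "sqrt (1 - 1 / (2 * (1 - sin t))) = 0" by simp
  qed auto
  have "-1 \<le> (sin t)\<^sup>2 + (cos t)\<^sup>2 * half_longitude_cos t \<and>
      (sin t)\<^sup>2 + (cos t)\<^sup>2 * half_longitude_cos t \<le> 1" if "0 \<le> t" for t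
  proof
    have "0 \<le> (sin t)\<^sup>2 + (cos t)\<^sup>2 * half_longitude_cos t"
      using half_longitude_cos_bounds[OF that] by simp
    then show "-1 \<le> (sin t)\<^sup>2 + (cos t)\<^sup>2 * half_longitude_cos t" by linarith
    have "(cos t)\<^sup>2 * half_longitude_cos t \<le> (cos t)\<^sup>2 * 1"
      using half_longitude_cos_bounds[OF that] by (intro mult_left_mono) auto
    then show "(sin t)\<^sup>2 + (cos t)\<^sup>2 * half_longitude_cos t \<le> 1"
      using sin_cos_squared_add[of t] by linarith
  qed
  then show ?thesis unfolding leg_def by (intro continuous_intros h) auto
qed

lemma continuous_on_side: "continuous_on X side"
  unfolding side_def by (rule continuous_on_cases_le) (auto intro!: continuous_intros)

lemma side_leg_0: "side 0 / leg 0 = 2"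
proof -
  have "sqrt (1 / 2) = cos (pi / 4)" by (simp add: cos_45 real_sqrt_divide field_simps)
  then have "leg 0 = arccos (cos (pi / 4))" by (simp add: leg_def half_longitude_cos_def)
  also have "\<dots> = pi / 4" by (intro arccos_cos) auto
  finally have leg: "leg 0 = pi / 4" .
  show ?thesis unfolding leg by (simp add: side_def)
qed

text \<open>With \<tau> = pi / 2 - \<theta> the leg x satisfies 2 sin (x / 2) = sqrt 2 sin \<tau>,
  so x is at least sqrt 2 sin \<tau>. The ratio 2 \<tau> / x is then at most sqrt 2 times \<tau> /
  sin \<tau>, and this tends to sqrt 2.\<close>

lemma side_leg_near_pi_half:
  assumes y: "sqrt 2 < y"
  shows "\<exists>\<theta>. 0 \<le> \<theta> \<and> \<theta> < pi / 2 \<and> side \<theta> / leg \<theta> \<le> y"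
proof -
  have "((\<lambda>x. (sin (0 + x) - sin 0) / x) \<longlongrightarrow> cos 0) (at (0::real))"
    using DERIV_sin[of "0::real"] unfolding DERIV_def .
  then have "((\<lambda>x. sqrt 2 / (sin x / x)) \<longlongrightarrow> sqrt 2 / 1) (at (0::real))"
    by (intro tendsto_intros) auto
  then have "eventually (\<lambda>x. sqrt 2 / (sin x / x) < y) (at (0::real))"
    using y by (intro order_tendstoD(2)) auto
  then obtain e where e: "0 < e" "\<And>x. x \<noteq> 0 \<Longrightarrow> dist x (0::real) < e \<Longrightarrow> sqrt 2 / (sin x / x) < y"
    unfolding eventually_at by auto
  \<comment> \<open>The bound pi / 6 puts \<theta> at pi / 3 or above, well inside the second
    branch.\<close>
  define \<tau> where "\<tau> = min (e / 2) (pi / 6)"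
  have \<tau>: "0 < \<tau>" "\<tau> \<le> pi / 6" "\<tau> < e" using e(1) by (auto simp: \<tau>_def)
  define \<theta> where "\<theta> = pi / 2 - \<tau>"
  have \<theta>: "0 \<le> \<theta>" "\<theta> < pi / 2" "\<not> \<theta> \<le> pi / 6" using \<tau> by (auto simp: \<theta>_def)
  have s: "sin \<theta> = cos \<tau>" by (simp add: \<theta>_def sin_diff)
  define x where "x = leg \<theta>"
  have x: "x = arccos ((cos \<tau>)\<^sup>2)" using \<theta>(3) by (simp add: x_def leg_def half_longitude_cos_def s)
  have "(0::real) \<le> (cos \<tau>)\<^sup>2" by simp
  then have "-1 \<le> (cos \<tau>)\<^sup>2" by linarith
  moreover have "(cos \<tau>)\<^sup>2 \<le> 1" by (simp add: abs_square_le_1)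
  ultimately have cx: "cos x = (cos \<tau>)\<^sup>2" and x0: "0 \<le> x" "x \<le> pi"
    unfolding x by (auto intro!: cos_arccos arccos_lbound arccos_ubound)
  have "2 * (sin \<tau>)\<^sup>2 = (2 * sin (x / 2))\<^sup>2"
    using cos_double_sin[of "x / 2"] cx sin_squared_eq[of \<tau>] by (simp add: power_mult_distrib)
  also have "\<dots> \<le> x\<^sup>2"
    using sin_x_le_x[of "x / 2"] sin_ge_zero[of "x / 2"] x0 by (intro power_mono) auto
  finally have "(sqrt 2 * sin \<tau>)\<^sup>2 \<le> x\<^sup>2" by (simp add: power_mult_distrib)
  then have le: "sqrt 2 * sin \<tau> \<le> x" using x0(1) by (rule power2_le_imp_le)
  have st: "0 < sin \<tau>" using \<tau> by (intro sin_gt_zero) auto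
  have "side \<theta> / leg \<theta> = 2 * \<tau> / x" using \<theta>(3) by (simp add: side_def x_def \<theta>_def)
  also have "\<dots> \<le> 2 * \<tau> / (sqrt 2 * sin \<tau>)" using le st \<tau> leg_pos[OF \<theta>(1,2)]
    by (intro divide_left_mono) (auto simp: x_def)
  also have "\<dots> = sqrt 2 / (sin \<tau> / \<tau>)"
    using st \<tau> real_sqrt_mult_self[of 2] by (simp add: field_simps del: real_sqrt_mult_self)
  also have "\<dots> \<le> y" using e(2)[of \<tau>] \<tau> by simp
  finally show ?thesis using \<theta> by blast
qed

text \<open>As \<theta> grows, the ratio of side to leg starts at 2 and gets arbitrarily close to
  sqrt 2 or below; the required value 2 powr (1 / g) lies in between, so the intermediate value
  theorem applies. It puts \<open>g\<close> in the image on which \<open>inv_into\<close> is a right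
  inverse.\<close>

lemma gamma0_surj:
  assumes g: "1 \<le> g" "g < 2"
  shows "\<exists>\<theta>\<in>{0..pi / 2}. gamma0 \<theta> = g"
proof -
  define y where "y = 2 powr (1 / g)"
  have "2 powr (1 / 2) < y" unfolding y_def using g by (intro powr_less_mono) (auto simp: field_simps)
  then obtain t where t: "0 \<le> t" "t < pi / 2" "side t / leg t \<le> y"
    using side_leg_near_pi_half[of y] by (auto simp: powr_half_sqrt)
  have "y \<le> 2 powr 1" unfolding y_def using g by (intro powr_mono) (auto simp: field_simps)
  then have y2: "y \<le> side 0 / leg 0" using side_leg_0 by simp
  have sub: "{0..t} \<subseteq> {0..<pi / 2}" using t by auto
  have "leg x \<noteq> 0" if "x \<in> {0..t}" for x using leg_pos[of x] that t by auto
  then have "continuous_on {0..t} (\<lambda>x. side x / leg x)"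
    by (intro continuous_intros continuous_on_side continuous_on_subset[OF continuous_on_leg sub]) auto
  then obtain \<theta> where \<theta>: "0 \<le> \<theta>" "\<theta> \<le> t" "side \<theta> / leg \<theta> = y"
    using IVT2'[of "\<lambda>x. side x / leg x" t y 0] t y2 by blast
  have "gamma0 \<theta> = inverse (log 2 y)" using gamma0_eq[of \<theta>] \<theta> t by simp
  also have "\<dots> = g" using g by (simp add: y_def)
  finally show ?thesis using \<theta> t by (intro bexI[of _ \<theta>]) auto
qed

lemma theta0_props:
  assumes "1 \<le> \<gamma>" "\<gamma> < 2"
  shows "0 \<le> theta0 \<gamma>" "theta0 \<gamma> < pi / 2" "gamma0 (theta0 \<gamma>) = enn2real \<gamma>"
proof -
  have "\<gamma> < top" using assms(2) by (rule less_trans) simp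
  then obtain g where g: "\<gamma> = ennreal g" "0 \<le> g" by (cases \<gamma>) auto
  have "1 \<le> g" using assms(1) g by simp
  moreover have "ennreal g < ennreal 2" using assms(2) g by simp
  then have "g < 2" using g by (simp add: ennreal_less_iff)
  ultimately have "enn2real \<gamma> \<in> gamma0 ` {0..pi / 2}" using gamma0_surj[of g] g by auto
  then have th: "theta0 \<gamma> \<in> {0..pi / 2}" "gamma0 (theta0 \<gamma>) = enn2real \<gamma>"
    using assms(2) inv_into_into[of "enn2real \<gamma>" gamma0 "{0..pi / 2}"]
      f_inv_into_f[of "enn2real \<gamma>" gamma0 "{0..pi / 2}"] by (simp_all add: theta0_def)
  \<comment> \<open>The value of \<open>gamma0\<close> at pi / 2 is set to 2, while the exponent is
    below 2.\<close>
  moreover have "theta0 \<gamma> \<noteq> pi / 2" using th(2) \<open>g < 2\<close> g by (auto simp: gamma0_def)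
  ultimately show "0 \<le> theta0 \<gamma>" "theta0 \<gamma> < pi / 2" "gamma0 (theta0 \<gamma>) = enn2real \<gamma>" by auto
qed

text \<open>This is the origin of the square root in \<open>gamma0\<close>: setting cos b = - sin
  \<theta>, that is b = pi / 2 + \<theta>, and solving for c^2 gives 1 - 1 / (2 (1 - sin \<theta>)).
  It is nonnegative as long as sin \<theta> is at most 1 / 2, which explains the threshold pi /
  6.\<close>

lemma three_points_side_leg:
  assumes \<theta>: "0 \<le> \<theta>" "\<theta> < pi / 2"
  shows "three_points.b \<theta> (half_longitude_cos \<theta>) = side \<theta>"
    and "three_points.a \<theta> (half_longitude_cos \<theta>) = leg \<theta>"
    and "side \<theta> \<le> pi / 2 + \<theta>"
proof -
  \<comment> \<open>The angles \<open>a\<close> and \<open>b\<close> are the same for every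
    exponent; 1 is an admissible one.\<close>
  interpret three_points 1 \<theta> "half_longitude_cos \<theta>"
    using \<theta> half_longitude_cos_bounds[OF \<theta>(1)] by unfold_locales auto
  show "a = leg \<theta>" by (simp add: a_def leg_def)
  show "side \<theta> \<le> pi / 2 + \<theta>" using \<theta> by (auto simp: side_def)
  have "cos b = cos (side \<theta>)"
  proof (cases "\<theta> \<le> pi / 6")
    case True
    define s where "s = sin \<theta>"
    have s: "s \<le> 1 / 2" using sin_le_half[OF \<theta>(1) True] by (simp add: s_def)
    have "(half_longitude_cos \<theta>)\<^sup>2 = 1 - 1 / (2 * (1 - s))"
      using True s by (simp add: half_longitude_cos_def flip: s_def)
    then have "cos b = (1 - s\<^sup>2) * (2 * (1 - 1 / (2 * (1 - s))) - 1) + s\<^sup>2"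
      unfolding cos_b by (simp add: s_def cos_squared_eq)
    also have "\<dots> = - s" using s by (simp add: field_simps power2_eq_square)
    also have "\<dots> = cos (side \<theta>)" using True by (simp add: side_def s_def cos_add)
    finally show ?thesis .
  next
    case False
    then show ?thesis unfolding cos_b
      by (simp add: half_longitude_cos_def side_def cos_diff cos_double)
  qed
  moreover have "0 \<le> b" "b \<le> pi" unfolding b_def using ang_bounds[OF norm_p1] by auto
  moreover have "0 \<le> side \<theta>" "side \<theta> \<le> pi" using \<theta> by (auto simp: side_def)
  ultimately show "b = side \<theta>" using cos_inj_pi by blast
qed

text \<open>Unfolds the meaning of \<open>gamma0\<close>: its value g is the exponent with log_2
  (side / leg) = 1 / g.\<close>

lemma side_powr_eq:
  assumes \<theta>: "0 \<le> \<theta>" "\<theta> < pi / 2" and g: "0 < g" "gamma0 \<theta> = g"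
  shows "side \<theta> powr g = 2 * leg \<theta> powr g"
proof -
  have pos: "0 < side \<theta>" "0 < leg \<theta>" using \<theta> leg_pos[OF \<theta>] by (auto simp: side_def)
  have "log 2 (side \<theta> / leg \<theta>) = 1 / g"
    using g gamma0_eq[OF \<theta>(2)] by (metis inverse_eq_divide inverse_inverse_eq)
  then have "side \<theta> / leg \<theta> = 2 powr (1 / g)" 
    using powr_log_cancel[of 2 "side \<theta> / leg \<theta>"] pos by simp
  then have "side \<theta> = 2 powr (1 / g) * leg \<theta>" using pos by (simp add: field_simps)
  then show ?thesis using pos g by (simp add: powr_mult powr_powr)
qed

section \<open>The bound\<close>

theorem theoremC1:
  fixes k :: real and \<gamma> :: ennreal
  assumes "k > 0" and "1 \<le> \<gamma>"
    and "constant_curvature_surface TYPE('a::metric_space) k"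
  shows "D_L TYPE('a) \<gamma> \<le> ennreal (1 / sqrt k * (theta0 \<gamma> + pi / 2))"
proof -
  interpret curved_surface k "TYPE('a)" using assms by unfold_locales auto
  have th0: "0 \<le> theta0 \<gamma>"
  proof (cases "\<gamma> < 2")
    case True
    then show ?thesis using theta0_props(1) assms(2) by blast
  qed (simp add: theta0_def)
  have bound: "D_L TYPE('a) \<gamma> \<le> ennreal (1 / sqrt k * (theta0 \<gamma> + pi / 2))"
    if A: "A \<notin> unique_mean_sets \<gamma>" "ediameter A \<le> ennreal d" "d * sqrt k \<le> theta0 \<gamma> + pi / 2"
    for A :: "'a set" and d
  proof -
    have "d \<le> 1 / sqrt k * (theta0 \<gamma> + pi / 2)" using A(3) assms(1) by (simp add: field_simps)
    then have "ennreal d \<le> ennreal (1 / sqrt k * (theta0 \<gamma> + pi / 2))" by (rule ennreal_leI)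
    then show ?thesis using D_L_le_ediameter[OF A(1)] A(2) by (meson order_trans)
  qed
  obtain F d where d: "0 < d" and F: "\<And>z. norm z = 1 \<Longrightarrow> patch z F d" using exists_covering by blast
  have pair: "D_L TYPE('a) \<gamma> \<le> ennreal (1 / sqrt k * (theta0 \<gamma> + pi / 2))"
    if "m1 \<noteq> m2" "dist p m1 = dist p q / 2" "dist m1 q = dist p q / 2"
      "dist p m2 = dist p q / 2" "dist m2 q = dist p q / 2" "dist p q * sqrt k \<le> theta0 \<gamma> + pi / 2"
    for p q m1 m2 :: 'a
  proof (rule bound)
    show "{p, q} \<notin> unique_mean_sets \<gamma>"
      by (rule two_midpoints_not_unique_mean[OF assms(2) that(1-5)])
    show "ediameter {p, q} \<le> ennreal (dist p q)" by (rule ediameter_le) (auto simp: dist_commute)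
  qed (use that(6) in simp)
  show ?thesis
  proof (cases "inj_on F (sphere 0 1)")
    case False
    obtain p q m1 m2 :: 'a where m: "m1 \<noteq> m2" "dist p q \<le> pi / 2 / sqrt k"
      "dist p m1 = dist p q / 2" "dist m1 q = dist p q / 2"
      "dist p m2 = dist p q / 2" "dist m2 q = dist p q / 2"
      by (rule covering_not_inj_midpoints[OF d F False])
    have "dist p q * sqrt k \<le> pi / 2" using m(2) assms(1) by (simp add: field_simps)
    then show ?thesis using th0 by (intro pair[OF m(1,3-6)]) simp
  next
    case True
    note surj = covering_inj_isometry(1)[OF d F True]
    have iso: "dist (F u) (F v) = ang u v / sqrt k" if "norm u = 1" "norm v = 1" for u v
      using covering_inj_isometry(2)[OF d F True that] by (simp add: dist_eq_D)
    show ?thesis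
    proof (cases "\<gamma> < 2")
      case \<gamma>: True
      define \<theta> g where "\<theta> = theta0 \<gamma>" and "g = enn2real \<gamma>"
      note th = theta0_props[OF assms(2) \<gamma>, folded \<theta>_def g_def]
      have "\<gamma> < top" using \<gamma> by (rule less_trans) simp
      then have geq: "\<gamma> = ennreal g" by (simp add: g_def)
      then have g1: "1 \<le> g" using assms(2) by simp
      interpret three_points g \<theta> "half_longitude_cos \<theta>"
        using g1 th half_longitude_cos_bounds[of \<theta>] by unfold_locales auto
      note sl = three_points_side_leg[OF th(1,2)]
      have bb: "b \<le> pi / 2 + \<theta>" "b powr g = 2 * a powr g"
        using sl side_powr_eq[OF th(1,2) _ th(3)] g1 by auto
      have K: "0 < sqrt k" using assms(1) by simp
      show ?thesis
      proof (rule bound)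
        show "{F s, F (p 1), F (p (-1))} \<notin> unique_mean_sets \<gamma>"
          unfolding geq by (rule not_unique_mean(1)[OF surj K iso bb])
        show "ediameter {F s, F (p 1), F (p (-1))} \<le> ennreal ((pi / 2 + \<theta>) / sqrt k)"
          by (rule not_unique_mean(2)[OF surj K iso bb])
        show "(pi / 2 + \<theta>) / sqrt k * sqrt k \<le> theta0 \<gamma> + pi / 2"
          using K by (simp add: \<theta>_def)
      qed
    next
      case \<gamma>: False
      \<comment> \<open>The points \<open>e 1\<close> and \<open>- e 1\<close> are antipodal, and
        \<open>e 2\<close> and \<open>e 3\<close> are two of their midpoints. Their angle pi is the
        bound in this range, where \<open>theta0\<close> is pi / 2.\<close>
      define e :: "3 \<Rightarrow> real ^ 3" where "e i = axis i 1" for i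
      have ne: "norm (e i) = 1" "norm (- e i) = 1" for i by (auto simp: e_def)
      have half: "ang (e i) (e j) = pi / 2" "ang (- e i) (e j) = pi / 2" if "i \<noteq> j" for i j
        using that by (auto simp: e_def ang_def inner_axis_axis)
      have opp: "ang (e i) (- e i) = pi" for i
        using ang_minus_left[OF ne(1) ne(1), of i i] ang_self[OF ne(1)] by (simp add: ang_commute)
      have "e 2 \<noteq> e 3" by (simp add: e_def axis_eq_axis)
      then have "F (e 2) \<noteq> F (e 3)" using inj_onD[OF True] ne by auto
      moreover have "dist (F (e 1)) (F (- e 1)) = pi / sqrt k" using iso ne opp by simp
      moreover have "dist (F (e 1)) (F (e i)) = pi / 2 / sqrt k" "dist (F (e i)) (F (- e 1)) = pi / 2 / sqrt k"
        if "i \<noteq> 1" for i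
        unfolding iso[OF ne(1) ne(1)] iso[OF ne(1) ne(2)] ang_commute[of _ "- e 1"]
        unfolding half[OF that[symmetric]] by simp_all
      ultimately show ?thesis using \<gamma> assms(1)
        by (intro pair[of "F (e 2)" "F (e 3)" "F (e 1)" "F (- e 1)"]) (simp_all add: theta0_def)
    qed
  qed
qed

end
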